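(* Let $(w_N)_{N\ge0}$ be the simple random walk on the locally free group on $n$ generators, let $l$ be its drift, and write $E\#T(w)=\lim_{N\to\infty}E\#T(w_N)$. Then asymptotically for $n\gg1$ (i.e. up to an error tending to $0$ as $n\to\infty$) $$l=1-\frac{E\#T(w)}{n}=1-\frac{1}{3-\alpha}=\frac{2-\alpha}{3-\alpha},$$ where $\alpha=\frac12(p^+-p^-)$ is the constant (depending on $n$) defined in the context.
   Context: The locally free group on $n$ generators is the group with generators $g_1,\dots,g_n$ and defining relations $g_jg_k=g_kg_j$ for $|j-k|\ge2$. $K(w)$ denotes the minimal length of a word in $g_1^{\pm1},\dots,g_n^{\pm1}$ representing $w$. The random walk starts at the identity and $w_{N+1}=w_N\,x$, where $x$ is chosen uniformly (probability $\frac1{2n}$ each) from $\{g_1^{\pm1},\dots,g_n^{\pm1}\}$, independently at each step. The drift is $l=\limsup_{N\to\infty}\frac{E\,K(w_N)}{N}$. The roof $T(w)$ of $w$ is the set of indices $i\in\{1,\dots,n\}$ such that $K(wg_i)=K(w)-1$ or $K(wg_i^{-1})=K(w)-1$, and $\#T(w)$ is its cardinality. For an element $w\neq 1$, $p_w^{+}$ (resp. $p_w^{-}$) is the conditional probability that one step of the walk from $w$ increases (resp. decreases) $\#T$ by one, given that this step reduces the length $K(w)$ by one. Set $p^{\pm}=E p_w^{\pm}$, where the expectation $E$ is taken in the stationary regime, i.e. as the limit as $N\to\infty$ of the expectation over $w=w_N$ (the limits being taken to exist); $\alpha=\frac12(p^+-p^-)$. *)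

theory Defs
  imports "HOL-Algebra.Group" "HOL-Probability.Probability"
begin

text \<open>The letter \<open>(i, True)\<close> stands for \<open>g\<^sub>i\<close> and \<open>(i, False)\<close> for its inverse.\<close>

type_synonym letter = "nat \<times> bool"

definition inv_letter :: "letter \<Rightarrow> letter" where
  "inv_letter x = (fst x, \<not> snd x)"

definition letters :: "nat \<Rightarrow> letter set" where
  "letters n = {1..n} \<times> UNIV"

text \<open>Equality of words in the group presented by the generators \<open>g\<^sub>1, \<dots>, g\<^sub>n\<close> and the relations
  \<open>g\<^sub>j g\<^sub>k = g\<^sub>k g\<^sub>j\<close> for \<open>|j - k| \<ge> 2\<close>.\<close>

inductive lf_eq :: "nat \<Rightarrow> letter list \<Rightarrow> letter list \<Rightarrow> bool" for n where
  lf_refl: "u \<in> lists (letters n) \<Longrightarrow> lf_eq n u u"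
| lf_sym: "lf_eq n u v \<Longrightarrow> lf_eq n v u"
| lf_trans: "lf_eq n u v \<Longrightarrow> lf_eq n v w \<Longrightarrow> lf_eq n u w"
| lf_cancel: "u \<in> lists (letters n) \<Longrightarrow> v \<in> lists (letters n) \<Longrightarrow> x \<in> letters n \<Longrightarrow>
    lf_eq n (u @ [x, inv_letter x] @ v) (u @ v)"
| lf_comm: "u \<in> lists (letters n) \<Longrightarrow> v \<in> lists (letters n) \<Longrightarrow>
    j \<in> {1..n} \<Longrightarrow> k \<in> {1..n} \<Longrightarrow> \<bar>int j - int k\<bar> \<ge> 2 \<Longrightarrow>
    lf_eq n (u @ [(j, True), (k, True)] @ v) (u @ [(k, True), (j, True)] @ v)"

definition lf_rel :: "nat \<Rightarrow> (letter list \<times> letter list) set" where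
  "lf_rel n = {(u, v). lf_eq n u v}"

definition lf_class :: "nat \<Rightarrow> letter list \<Rightarrow> letter list set" where
  "lf_class n u = lf_rel n `` {u}"

definition lf_group :: "nat \<Rightarrow> letter list set monoid" where
  "lf_group n =
     \<lparr>carrier = lists (letters n) // lf_rel n,
      monoid.mult = (\<lambda>A B. \<Union>u\<in>A. \<Union>v\<in>B. lf_class n (u @ v)),
      one = lf_class n []\<rparr>"

abbreviation lf_letter :: "nat \<Rightarrow> letter \<Rightarrow> letter list set" where
  "lf_letter n x \<equiv> lf_class n [x]"

lemma inv_letter_in_letters [simp]: "inv_letter x \<in> letters n \<longleftrightarrow> x \<in> letters n"
  by (cases x) (auto simp: inv_letter_def letters_def)

lemma inv_letter_inv_letter [simp]: "inv_letter (inv_letter x) = x"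
  by (simp add: inv_letter_def)

lemma lf_eq_lists: "lf_eq n u v \<Longrightarrow> u \<in> lists (letters n) \<and> v \<in> lists (letters n)"
  by (induction rule: lf_eq.induct) (auto simp: letters_def inv_letter_def)

lemma lf_eq_context:
  assumes "lf_eq n u v" "a \<in> lists (letters n)" "b \<in> lists (letters n)"
  shows "lf_eq n (a @ u @ b) (a @ v @ b)"
  using assms
proof (induction rule: lf_eq.induct)
  case (lf_cancel u v x)
  then show ?case
    using lf_eq.lf_cancel[of "a @ u" n "v @ b" x] by (simp add: append_in_lists_conv)
next
  case (lf_comm u v j k)
  then show ?case
    using lf_eq.lf_comm[of "a @ u" n "v @ b" j k] by (simp add: append_in_lists_conv)
next
  case (lf_refl u)
  then show ?case by (simp add: lf_eq.lf_refl append_in_lists_conv)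
qed (blast intro: lf_eq.lf_sym lf_eq.lf_trans)+

lemma lf_eq_append:
  assumes "lf_eq n u u'" "lf_eq n v v'"
  shows "lf_eq n (u @ v) (u' @ v')"
proof -
  have "lf_eq n ([] @ u @ v) ([] @ u' @ v)"
    using lf_eq_context[OF assms(1), of "[]" v] lf_eq_lists[OF assms(2)] by simp
  moreover have "lf_eq n (u' @ v @ []) (u' @ v' @ [])"
    using lf_eq_context[OF assms(2), of u' "[]"] lf_eq_lists[OF assms(1)] by simp
  ultimately show ?thesis
    by (metis append_Nil append_Nil2 lf_eq.lf_trans)
qed

lemma equiv_lf_rel: "equiv (lists (letters n)) (lf_rel n)"
  by (rule equivI)
    (auto simp: lf_rel_def refl_on_def sym_def trans_def
       intro: lf_eq.lf_refl lf_eq.lf_sym lf_eq.lf_trans dest: lf_eq_lists)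

lemma mem_lf_class [simp]: "v \<in> lf_class n u \<longleftrightarrow> lf_eq n u v"
  by (simp add: lf_class_def lf_rel_def)

lemma lf_class_eq_iff:
  assumes "u \<in> lists (letters n)" "v \<in> lists (letters n)"
  shows "lf_class n u = lf_class n v \<longleftrightarrow> lf_eq n u v"
  using eq_equiv_class_iff[OF equiv_lf_rel assms] by (simp add: lf_class_def lf_rel_def)

lemma lf_group_carrierE:
  assumes "A \<in> carrier (lf_group n)"
  obtains u where "u \<in> lists (letters n)" "A = lf_class n u"
  using assms by (auto simp: lf_group_def lf_class_def quotient_def)

lemma lf_class_in_carrier [simp]:
  "u \<in> lists (letters n) \<Longrightarrow> lf_class n u \<in> carrier (lf_group n)"
  by (auto simp: lf_group_def lf_class_def quotient_def)

lemma lf_mult_class: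
  assumes "u \<in> lists (letters n)" "v \<in> lists (letters n)"
  shows "lf_class n u \<otimes>\<^bsub>lf_group n\<^esub> lf_class n v = lf_class n (u @ v)"
proof (rule Set.set_eqI)
  fix w
  show "w \<in> lf_class n u \<otimes>\<^bsub>lf_group n\<^esub> lf_class n v \<longleftrightarrow> w \<in> lf_class n (u @ v)"
  proof
    assume "w \<in> lf_class n u \<otimes>\<^bsub>lf_group n\<^esub> lf_class n v"
    then show "w \<in> lf_class n (u @ v)"
      by (auto simp: lf_group_def intro: lf_eq.lf_trans[OF lf_eq_append])
  next
    assume "w \<in> lf_class n (u @ v)"
    moreover have "u \<in> lf_class n u" "v \<in> lf_class n v"
      using assms by (simp_all add: lf_eq.lf_refl del: in_lists_conv_set)
    ultimately show "w \<in> lf_class n u \<otimes>\<^bsub>lf_group n\<^esub> lf_class n v"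
      unfolding lf_group_def by (simp del: mem_lf_class) blast
  qed
qed

lemma lf_one: "\<one>\<^bsub>lf_group n\<^esub> = lf_class n []"
  by (simp add: lf_group_def)

lemma lf_eq_inverse:
  "u \<in> lists (letters n) \<Longrightarrow> lf_eq n (rev (map inv_letter u) @ u) []"
proof (induction u)
  case Nil
  then show ?case by (simp add: lf_eq.lf_refl)
next
  case (Cons x u)
  then have mem: "rev (map inv_letter u) \<in> lists (letters n)" "u \<in> lists (letters n)" "x \<in> letters n"
    by (auto simp: in_lists_conv_set)
  then have "lf_eq n (rev (map inv_letter u) @ [inv_letter x, x] @ u) (rev (map inv_letter u) @ u)"
    using lf_eq.lf_cancel[of "rev (map inv_letter u)" n u "inv_letter x"] by simp
  then show ?case
    using Cons.IH[OF mem(2)] by (auto intro: lf_eq.lf_trans)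
qed

lemma group_lf_group: "group (lf_group n)"
proof (rule groupI)
  fix A assume "A \<in> carrier (lf_group n)"
  then obtain u where u: "u \<in> lists (letters n)" "A = lf_class n u"
    by (rule lf_group_carrierE)
  have v: "rev (map inv_letter u) \<in> lists (letters n)"
    using u by (auto simp: in_lists_conv_set)
  have "lf_class n (rev (map inv_letter u)) \<otimes>\<^bsub>lf_group n\<^esub> A = \<one>\<^bsub>lf_group n\<^esub>"
    using u v lf_eq_inverse[OF u(1)]
    by (simp add: lf_mult_class lf_one lf_class_eq_iff append_in_lists_conv)
  then show "\<exists>B\<in>carrier (lf_group n). B \<otimes>\<^bsub>lf_group n\<^esub> A = \<one>\<^bsub>lf_group n\<^esub>"
    using v lf_class_in_carrier by blast
next
  fix A B assume "A \<in> carrier (lf_group n)" "B \<in> carrier (lf_group n)"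
  then show "A \<otimes>\<^bsub>lf_group n\<^esub> B \<in> carrier (lf_group n)"
    by (elim lf_group_carrierE) (simp add: lf_mult_class append_in_lists_conv del: in_lists_conv_set)
next
  fix A B C
  assume "A \<in> carrier (lf_group n)" "B \<in> carrier (lf_group n)" "C \<in> carrier (lf_group n)"
  then show "A \<otimes>\<^bsub>lf_group n\<^esub> B \<otimes>\<^bsub>lf_group n\<^esub> C =
      A \<otimes>\<^bsub>lf_group n\<^esub> (B \<otimes>\<^bsub>lf_group n\<^esub> C)"
    by (elim lf_group_carrierE) (simp add: lf_mult_class append_in_lists_conv del: in_lists_conv_set)
next
  fix A assume "A \<in> carrier (lf_group n)"
  then show "\<one>\<^bsub>lf_group n\<^esub> \<otimes>\<^bsub>lf_group n\<^esub> A = A"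
    by (elim lf_group_carrierE) (simp add: lf_one lf_mult_class del: in_lists_conv_set)
qed (simp add: lf_one)

lemma inv_lf_letter:
  assumes "i \<in> {1..n}"
  shows "inv\<^bsub>lf_group n\<^esub> (lf_letter n (i, True)) = lf_letter n (i, False)"
proof -
  interpret group "lf_group n" by (rule group_lf_group)
  have mem: "[(i, b)] \<in> lists (letters n)" for b
    using assms by (simp add: letters_def)
  have "lf_eq n [(i, False), (i, True)] []"
    using lf_eq_inverse[OF mem[of True]] by (simp add: inv_letter_def)
  then have "lf_letter n (i, False) \<otimes>\<^bsub>lf_group n\<^esub> lf_letter n (i, True) = \<one>\<^bsub>lf_group n\<^esub>"
    using mem by (simp add: lf_mult_class lf_one lf_class_eq_iff letters_def)
  then show ?thesis
    using mem by (intro inv_equality) auto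
qed

definition K :: "nat \<Rightarrow> letter list set \<Rightarrow> nat" where
  "K n w = (LEAST k. \<exists>u\<in>w. length u = k)"

text \<open>Only the one-dimensional marginals of the walk are needed: \<open>walk n N\<close> is the law of \<open>w\<^sub>N\<close>.
  For \<open>n \<ge> 1\<close> the step distribution is uniform on the \<open>2n\<close> letters.\<close>

definition step :: "nat \<Rightarrow> letter pmf" where
  "step n = pmf_of_set (letters n)"

primrec walk :: "nat \<Rightarrow> nat \<Rightarrow> letter list set pmf" where
  "walk n 0 = return_pmf \<one>\<^bsub>lf_group n\<^esub>"
| "walk n (Suc N) =
     bind_pmf (walk n N) (\<lambda>w. map_pmf (\<lambda>x. w \<otimes>\<^bsub>lf_group n\<^esub> lf_letter n x) (step n))"

text \<open>The limit \<open>stat_mean\<close> is only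
  meaningful where the sequence converges.\<close>

definition walk_mean :: "nat \<Rightarrow> (letter list set \<Rightarrow> real) \<Rightarrow> nat \<Rightarrow> real" where
  "walk_mean n f N = measure_pmf.expectation (walk n N) f"

definition stat_mean :: "nat \<Rightarrow> (letter list set \<Rightarrow> real) \<Rightarrow> real" where
  "stat_mean n f = lim (walk_mean n f)"

definition drift :: "nat \<Rightarrow> real" where
  "drift n = real_of_ereal
     (limsup (\<lambda>N. ereal (walk_mean n (\<lambda>w. real (K n w)) N / real N)))"

definition roof :: "nat \<Rightarrow> letter list set \<Rightarrow> nat set" where
  "roof n w = {i \<in> {1..n}.
     K n (w \<otimes>\<^bsub>lf_group n\<^esub> lf_letter n (i, True)) + 1 = K n w \<or>
     K n (w \<otimes>\<^bsub>lf_group n\<^esub> lf_letter n (i, False)) + 1 = K n w}"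

text \<open>At the identity no step reduces the length, and the conditional probabilities below take the
  value 0. This has no influence on the limits, since the probability
  of \<open>w\<^sub>N = 1\<close> tends to 0.\<close>

definition p_plus_at :: "nat \<Rightarrow> letter list set \<Rightarrow> real" where
  "p_plus_at n w = cond_prob (measure_pmf (step n))
     (\<lambda>x. card (roof n (w \<otimes>\<^bsub>lf_group n\<^esub> lf_letter n x)) = card (roof n w) + 1)
     (\<lambda>x. K n (w \<otimes>\<^bsub>lf_group n\<^esub> lf_letter n x) + 1 = K n w)"

definition p_minus_at :: "nat \<Rightarrow> letter list set \<Rightarrow> real" where
  "p_minus_at n w = cond_prob (measure_pmf (step n))
     (\<lambda>x. card (roof n (w \<otimes>\<^bsub>lf_group n\<^esub> lf_letter n x)) + 1 = card (roof n w))
     (\<lambda>x. K n (w \<otimes>\<^bsub>lf_group n\<^esub> lf_letter n x) + 1 = K n w)"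

definition mean_roof :: "nat \<Rightarrow> real" where
  "mean_roof n = stat_mean n (\<lambda>w. real (card (roof n w)))"

definition p_plus :: "nat \<Rightarrow> real" where
  "p_plus n = stat_mean n (p_plus_at n)"

definition p_minus :: "nat \<Rightarrow> real" where
  "p_minus n = stat_mean n (p_minus_at n)"

definition alpha :: "nat \<Rightarrow> real" where
  "alpha n = (p_plus n - p_minus n) / 2"

end

theory Submission
  imports Defs "HOL-Real_Asymp.Real_Asymp"
begin

text \<open>Each step changes the length by \<open>\<plusminus>1\<close> and shortens \<open>w\<close> with probability \<open>#T(w) / 2n\<close>, so the drift is
  exactly \<open>1 - E #T / n\<close>. In one step \<open>E #T\<close> changes by
  \<open>1 - 3 \<tau> + \<tau> (p\<^sub>w\<^sup>+ - p\<^sub>w\<^sup>-) / 2 + O(1/n)\<close>, where \<open>\<tau> = #T / n\<close>; stationarity gives the claim provided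
  \<open>\<tau>\<close> is asymptotically uncorrelated with \<open>p\<^sub>w\<^sup>+ - p\<^sub>w\<^sup>-\<close>. This holds because \<open>\<tau>\<close> concentrates as
  \<open>n \<rightarrow> \<infinity>\<close>, uniformly in time. After \<open>s n\<close> steps with \<open>s\<close> fixed the variance of \<open>\<tau>\<close> is \<open>O(1/n)\<close>, since
  the influence of one step spreads at bounded speed. For later times replace \<open>w\<^sub>N\<close> by its inverse, which has the
  same law. The roof of the inverse changes at \<open>i\<close> only when the projection of the walk to the free
  group on \<open>g\<^sub>i\<close> and a neighbouring generator is trivial just before or after the step, which has
  probability at most \<open>2 exp (- s / 4)\<close> after \<open>s n\<close> steps, and these probabilities are summable.\<close>

section \<open>Pilings\<close>

text \<open>A piling (Crisp, Godelle and Wiest) has one stack per generator. The letter \<open>g\<^sub>i\<close> or its inverse puts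
  its sign on stack \<open>i\<close> and the blank \<open>None\<close> on the two neighbouring stacks, unless it cancels against
  the top of stack \<open>i\<close>. The resulting piling depends only on the group element, whose length is the number of
  signs and whose roof is the set of stacks with a sign on top.\<close>

type_synonym piling = "nat \<Rightarrow> bool option list"

definition nbr :: "nat \<Rightarrow> nat \<Rightarrow> bool" where
  "nbr i j \<longleftrightarrow> i = Suc j \<or> j = Suc i"

text \<open>Stacks are indexed by all natural numbers, so the first and the last generator also put
  blanks on stacks \<open>0\<close> and \<open>n + 1\<close>. This avoids a case distinction at the
  ends.\<close>

definition push :: "letter \<Rightarrow> piling \<Rightarrow> piling" where
  "push x p = (\<lambda>j. if j = fst x then Some (snd x) # p j
                   else if nbr j (fst x) then None # p j else p j)"

definition pop :: "nat \<Rightarrow> piling \<Rightarrow> piling" where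
  "pop i p = (\<lambda>j. if j = i \<or> nbr j i then tl (p j) else p j)"

definition tops :: "piling \<Rightarrow> letter set" where
  "tops p = {y. \<exists>r. p (fst y) = Some (snd y) # r}"

definition put :: "piling \<Rightarrow> letter \<Rightarrow> piling" where
  "put p x = (if inv_letter x \<in> tops p then pop (fst x) p else push x p)"

definition piling_of :: "letter list \<Rightarrow> piling" where
  "piling_of u = foldl put (\<lambda>_. []) u"

text \<open>Only pushes that do not cancel occur here, so these are the pilings of reduced words and
  induction never meets a \<open>pop\<close>. Closure under \<open>put\<close> follows in
  \<open>valid_put\<close>.\<close>

inductive valid :: "piling \<Rightarrow> bool" where
  valid_empty: "valid (\<lambda>_. [])"
| valid_push: "valid p \<Longrightarrow> inv_letter x \<notin> tops p \<Longrightarrow> valid (push x p)"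

section \<open>The piling as an invariant of the group element\<close>

lemma nbr_sym: "nbr i j \<longleftrightarrow> nbr j i"
  by (auto simp: nbr_def)

lemma nbr_irrefl [simp]: "\<not> nbr i i"
  by (simp add: nbr_def)

lemma fst_inv_letter [simp]: "fst (inv_letter x) = fst x"
  by (simp add: inv_letter_def)

lemma inv_letter_neq [simp]: "inv_letter x \<noteq> x" "x \<noteq> inv_letter x"
  by (cases x; simp add: inv_letter_def)+

lemma letter_cases: "fst x = fst y \<Longrightarrow> x = y \<or> x = inv_letter y"
  by (cases x; cases y; auto simp: inv_letter_def)

lemma tops_unique: "x \<in> tops p \<Longrightarrow> y \<in> tops p \<Longrightarrow> fst x = fst y \<Longrightarrow> x = y"
  by (fastforce simp: tops_def prod_eq_iff)

lemma inj_on_fst_tops: "inj_on fst (tops p)"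
  using tops_unique by (blast intro: inj_onI)

lemma tops_empty [simp]: "tops (\<lambda>_. []) = {}"
  by (simp add: tops_def)

lemma tops_push: "tops (push x p) = insert x {y \<in> tops p. fst y \<noteq> fst x \<and> \<not> nbr (fst y) (fst x)}"
  by (cases x) (auto simp: tops_def push_def split: if_splits)

lemma pop_push [simp]: "pop (fst x) (push x p) = p"
  by (auto simp: pop_def push_def)

lemma push_commute:
  "fst x \<noteq> fst y \<Longrightarrow> \<not> nbr (fst x) (fst y) \<Longrightarrow> push x (push y p) = push y (push x p)"
  by (rule ext) (auto simp: push_def nbr_sym)

text \<open>Consider the last time \<open>y\<close> was pushed. Everything pushed afterwards lies on
  stacks neither equal nor adjacent to that of \<open>y\<close>, since otherwise \<open>y\<close>
  would be covered. Those pushes commute with \<open>y\<close>, so \<open>y\<close> can be taken to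
  come last.\<close>

lemma valid_topE:
  assumes "valid p" "y \<in> tops p"
  shows "\<exists>q. valid q \<and> p = push y q \<and> inv_letter y \<notin> tops q"
  using assms
proof (induction rule: valid.induct)
  case (valid_push p x)
  show ?case
  proof (cases "y = x")
    case False
    with valid_push.prems have y: "y \<in> tops p" "fst y \<noteq> fst x" "\<not> nbr (fst y) (fst x)"
      by (auto simp: tops_push)
    with valid_push.IH obtain q where q: "valid q" "p = push y q" "inv_letter y \<notin> tops q"
      by blast
    have "inv_letter x \<notin> tops q"
      using valid_push.hyps(2) y by (auto simp: q(2) tops_push nbr_sym)
    then have "valid (push x q)"
      by (rule valid.valid_push[OF q(1)])
    moreover have "inv_letter y \<notin> tops (push x q)"
      using q(3) y(2) by (auto simp: tops_push)
    moreover have "push x p = push y (push x q)"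
      unfolding q(2) using y by (intro push_commute) (auto simp: nbr_sym)
    ultimately show ?thesis by blast
  qed (use valid_push.hyps in auto)
qed simp

text \<open>If \<open>y\<close> is taken as the last push, it has just covered the adjacent stacks
  with blanks.\<close>

lemma valid_not_nbr:
  assumes "valid p" "x \<in> tops p" "y \<in> tops p"
  shows "\<not> nbr (fst x) (fst y)"
proof -
  obtain q where "p = push y q"
    using valid_topE[OF assms(1,3)] by blast
  with assms(2) show ?thesis
    by (auto simp: tops_push)
qed

lemma valid_put: "valid p \<Longrightarrow> valid (put p x)"
  using valid_topE[of p "inv_letter x"] pop_push[of "inv_letter x"]
  by (auto simp: put_def intro: valid.valid_push)

text \<open>When \<open>x\<close> cancels, \<open>valid_topE\<close> shows that \<open>x\<close> is
  not on top of what remains, so \<open>inv_letter x\<close> is pushed back instead of cancelling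
  again.\<close>

lemma put_inverse:
  assumes "valid p"
  shows "put (put p x) (inv_letter x) = p"
proof (cases "inv_letter x \<in> tops p")
  case True
  then obtain q where "p = push (inv_letter x) q" "x \<notin> tops q"
    using valid_topE[OF assms] by fastforce
  then show ?thesis
    using True pop_push[of "inv_letter x" q] by (simp add: put_def)
next
  case False
  then show ?thesis
    by (simp add: put_def tops_push)
qed

lemma tops_put_iff:
  "fst y \<noteq> fst x \<Longrightarrow> \<not> nbr (fst y) (fst x) \<Longrightarrow> y \<in> tops (put p x) \<longleftrightarrow> y \<in> tops p"
  by (auto simp: put_def tops_def pop_def push_def)

text \<open>Validity matters on a stack adjacent to both letters: since \<open>p\<close> is a push
  of \<open>inv_letter x\<close>, the entry popped there is a blank, just like the one that pushing
  \<open>y\<close> adds.\<close>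

lemma put_commute_aux:
  assumes "valid p" "fst x \<noteq> fst y" "\<not> nbr (fst x) (fst y)"
    "inv_letter x \<in> tops p" "inv_letter y \<notin> tops p"
  shows "put (put p x) y = put (put p y) x"
proof -
  obtain q where q: "p = push (inv_letter x) q"
    using valid_topE[OF assms(1,4)] by blast
  have "inv_letter y \<notin> tops q"
    using assms by (auto simp: q tops_push nbr_sym)
  then have "put (put p x) y = push y q"
    using assms pop_push[of "inv_letter x" q] by (simp add: put_def q)
  moreover have "put p y = push (inv_letter x) (push y q)"
    using assms by (simp add: put_def q push_commute nbr_sym)
  ultimately show ?thesis
    using pop_push[of "inv_letter x" "push y q"] by (simp add: put_def tops_push)
qed

text \<open>Neither letter touches the stack of the other, so whether a letter cancels does not
  depend on the order. This leaves four cases, two of them covered by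
  \<open>put_commute_aux\<close>.\<close>

lemma put_commute:
  assumes "valid p" "fst x \<noteq> fst y" "\<not> nbr (fst x) (fst y)"
  shows "put (put p x) y = put (put p y) x"
proof -
  have *: "fst y \<noteq> fst x" "\<not> nbr (fst y) (fst x)"
    using assms by (auto simp: nbr_sym)
  have iff: "inv_letter y \<in> tops (put p x) \<longleftrightarrow> inv_letter y \<in> tops p"
    "inv_letter x \<in> tops (put p y) \<longleftrightarrow> inv_letter x \<in> tops p"
    using assms * by (auto intro!: tops_put_iff)
  consider "inv_letter x \<in> tops p" "inv_letter y \<notin> tops p"
    | "inv_letter x \<notin> tops p" "inv_letter y \<in> tops p"
    | "inv_letter x \<in> tops p" "inv_letter y \<in> tops p"
    | "inv_letter x \<notin> tops p" "inv_letter y \<notin> tops p"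
    by blast
  then show ?thesis
  proof cases
    case 3
    then have "put (put p x) y = pop (fst y) (pop (fst x) p)"
      "put (put p y) x = pop (fst x) (pop (fst y) p)"
      using iff by (simp_all add: put_def)
    then show ?thesis
      using assms * by (auto simp: pop_def fun_eq_iff)
  next
    case 4
    then have "put (put p x) y = push y (push x p)" "put (put p y) x = push x (push y p)"
      using iff by (simp_all add: put_def)
    then show ?thesis
      using push_commute[OF assms(2,3)] by simp
  qed (use put_commute_aux assms * in metis)+
qed

lemma piling_of_Nil [simp]: "piling_of [] = (\<lambda>_. [])"
  by (simp add: piling_of_def)

lemma piling_of_snoc [simp]: "piling_of (u @ [x]) = put (piling_of u) x"
  by (simp add: piling_of_def)

lemma piling_of_append: "piling_of (u @ v) = foldl put (piling_of u) v"
  by (simp add: piling_of_def)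

lemma valid_piling_of: "valid (piling_of u)"
  by (induction u rule: rev_induct) (auto intro: valid_put valid_empty)

text \<open>The two kinds of relation are exactly \<open>put_inverse\<close> and
  \<open>put_commute\<close>. Functions of the piling are therefore functions of the group
  element.\<close>

lemma piling_of_cong: "lf_eq n u v \<Longrightarrow> piling_of u = piling_of v"
proof (induction rule: lf_eq.induct)
  case (lf_cancel u v x)
  then show ?case
    using put_inverse[OF valid_piling_of] by (simp add: piling_of_append)
next
  case (lf_comm u v j k)
  then show ?case
    using put_commute[OF valid_piling_of, of "(j, True)" "(k, True)"]
    by (force simp: piling_of_append nbr_def)
qed auto


text \<open>The defining relations mention positive letters only. Inserting \<open>x\<close> and its
  inverse on the right and commuting \<open>x\<close> past \<open>y\<close> extends commutation to
  the inverse letter.\<close>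

lemma lf_eq_commute_letter:
  assumes "lf_eq n [x, y] [y, x]" "x \<in> letters n" "y \<in> letters n"
  shows "lf_eq n [inv_letter x, y] [y, inv_letter x]"
proof -
  let ?x = "inv_letter x"
  have "lf_eq n [?x, y] [?x, y, x, ?x]"
    using lf_eq.lf_cancel[of "[?x, y]" n "[]" x] assms by (auto dest: lf_eq.lf_sym)
  moreover have "lf_eq n [?x, y, x, ?x] [?x, x, y, ?x]"
    using lf_eq_context[OF lf_eq.lf_sym[OF assms(1)], of "[?x]" "[?x]"] assms by simp
  moreover have "lf_eq n [?x, x, y, ?x] [y, ?x]"
    using lf_eq.lf_cancel[of "[]" n "[y, ?x]" ?x] assms by simp
  ultimately show ?thesis
    by (blast intro: lf_eq.lf_trans)
qed

lemma lf_eq_commute: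
  assumes "x \<in> letters n" "y \<in> letters n" "fst x \<noteq> fst y" "\<not> nbr (fst x) (fst y)"
  shows "lf_eq n [x, y] [y, x]"
proof -
  obtain j b k c where xy: "x = (j, b)" "y = (k, c)"
    by (cases x; cases y) auto
  have m: "(j, d) \<in> letters n" "(k, d) \<in> letters n" for d
    using assms by (auto simp: xy letters_def)
  have "lf_eq n [(j, True), (k, True)] [(k, True), (j, True)]"
    using lf_eq.lf_comm[of "[]" n "[]" j k] assms by (auto simp: xy letters_def nbr_def)
  then have 1: "lf_eq n [(j, b), (k, True)] [(k, True), (j, b)]"
    using lf_eq_commute_letter[of n "(j, True)" "(k, True)"] m
    by (cases b) (auto simp: inv_letter_def)
  have "lf_eq n [(k, True), (j, b)] [(j, b), (k, True)]"
    using 1 by (rule lf_eq.lf_sym)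
  then have "lf_eq n [(k, c), (j, b)] [(j, b), (k, c)]"
    using lf_eq_commute_letter[of n "(k, True)" "(j, b)"] m
    by (cases c) (auto simp: inv_letter_def)
  then show ?thesis
    unfolding xy by (rule lf_eq.lf_sym)
qed

lemma lf_eq_commute_word:
  assumes "x \<in> letters n" "v \<in> lists (letters n)"
    "\<And>y. y \<in> set v \<Longrightarrow> fst x \<noteq> fst y \<and> \<not> nbr (fst x) (fst y)"
  shows "lf_eq n (v @ [x]) (x # v)"
  using assms
proof (induction v)
  case (Cons y v)
  then have "lf_eq n (y # v @ [x]) (y # x # v)"
    using lf_eq_context[of n "v @ [x]" "x # v" "[y]" "[]"] by simp
  moreover have "lf_eq n (y # x # v) (x # y # v)"
    using lf_eq_context[OF lf_eq_commute[of y n x], of "[]" v] Cons.prems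
    by (simp add: nbr_sym) metis
  ultimately show ?case
    by (auto intro: lf_eq.lf_trans)
qed (simp add: lf_eq.lf_refl)

section \<open>Reduced words, the length and the roof\<close>

definition psize :: "nat \<Rightarrow> piling \<Rightarrow> nat" where
  "psize n p = (\<Sum>i=1..n. length (filter (\<lambda>e. e \<noteq> None) (p i)))"

lemma psize_empty [simp]: "psize n (\<lambda>_. []) = 0"
  by (simp add: psize_def)

lemma psize_push:
  assumes "x \<in> letters n"
  shows "psize n (push x p) = Suc (psize n p)"
proof -
  let ?f = "\<lambda>p i. length (filter (\<lambda>e. e \<noteq> None) (p i))"
  have x: "fst x \<in> {1..n}"
    using assms by (auto simp: letters_def)
  have "(\<Sum>i\<in>{1..n} - {fst x}. ?f (push x p) i) = (\<Sum>i\<in>{1..n} - {fst x}. ?f p i)"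
    by (intro sum.cong) (auto simp: push_def)
  then show ?thesis
    using sum.remove[OF _ x, of "?f (push x p)"] sum.remove[OF _ x, of "?f p"]
    by (simp add: psize_def push_def)
qed

lemma psize_put:
  assumes "x \<in> letters n" "valid p"
  shows "inv_letter x \<in> tops p \<Longrightarrow> Suc (psize n (put p x)) = psize n p"
    and "inv_letter x \<notin> tops p \<Longrightarrow> psize n (put p x) = Suc (psize n p)"
proof -
  assume "inv_letter x \<in> tops p"
  then obtain q where "p = push (inv_letter x) q"
    using valid_topE[OF assms(2)] by blast
  then show "Suc (psize n (put p x)) = psize n p"
    using \<open>inv_letter x \<in> tops p\<close> assms(1) pop_push[of "inv_letter x" q]
    by (simp add: put_def psize_push)
next
  assume "inv_letter x \<notin> tops p"
  then show "psize n (put p x) = Suc (psize n p)"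
    using assms by (simp add: put_def psize_push)
qed

text \<open>Stated through pilings: no letter cancels while the piling is built. That such words are
  shortest representatives comes out in \<open>K_eq_psize\<close>.\<close>

definition reduced :: "nat \<Rightarrow> letter list \<Rightarrow> bool" where
  "reduced n u \<longleftrightarrow> u \<in> lists (letters n) \<and> psize n (piling_of u) = length u"

lemma psize_le_length: "u \<in> lists (letters n) \<Longrightarrow> psize n (piling_of u) \<le> length u"
proof (induction u rule: rev_induct)
  case (snoc x u)
  then show ?case
    using psize_put[OF _ valid_piling_of, of x n u] by (cases "inv_letter x \<in> tops (piling_of u)") auto
qed simp

lemma reduced_snoc:
  "reduced n (u @ [x]) \<longleftrightarrow> reduced n u \<and> x \<in> letters n \<and> inv_letter x \<notin> tops (piling_of u)"
proof (cases "u \<in> lists (letters n) \<and> x \<in> letters n")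
  case True
  then show ?thesis
    using psize_put[OF _ valid_piling_of, of x n u] psize_le_length[of u n]
    by (cases "inv_letter x \<in> tops (piling_of u)") (auto simp: reduced_def)
qed (auto simp: reduced_def)

lemma reduced_lists: "reduced n u \<Longrightarrow> u \<in> lists (letters n)"
  by (simp add: reduced_def)

text \<open>The counterpart of \<open>valid_topE\<close> for words: a letter seen on top commutes
  with everything after its last occurrence and can be moved to the end.\<close>

lemma reduced_topE:
  assumes "reduced n u" "y \<in> tops (piling_of u)"
  shows "\<exists>v. lf_eq n u (v @ [y]) \<and> Suc (length v) = length u"
  using assms
proof (induction u rule: rev_induct)
  case (snoc x u)
  then have red: "reduced n u" "x \<in> letters n" "inv_letter x \<notin> tops (piling_of u)"
    by (auto simp: reduced_snoc)
  show ?case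
  proof (cases "y = x")
    case True
    have "lf_eq n (u @ [x]) (u @ [x])"
      using reduced_lists[OF snoc.prems(1)] by (rule lf_eq.lf_refl)
    with True show ?thesis
      by (intro exI[of _ u]) auto
  next
    case False
    then have y: "y \<in> tops (piling_of u)" "fst y \<noteq> fst x" "\<not> nbr (fst y) (fst x)"
      using snoc.prems(2) red(3) by (auto simp: put_def tops_push)
    obtain v where v: "lf_eq n u (v @ [y])" "Suc (length v) = length u"
      using snoc.IH[OF red(1) y(1)] by blast
    have m: "v \<in> lists (letters n)" "y \<in> letters n"
      using lf_eq_lists[OF v(1)] by auto
    have "lf_eq n (u @ [x]) (v @ [y] @ [x])"
      using lf_eq_append[OF v(1) lf_eq.lf_refl[of "[x]"]] red(2) by simp
    moreover have "lf_eq n (v @ [y, x] @ []) (v @ [x, y] @ [])"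
      using m red(2) y by (intro lf_eq_context lf_eq_commute) auto
    ultimately have "lf_eq n (u @ [x]) ((v @ [x]) @ [y])"
      by (auto intro: lf_eq.lf_trans)
    then show ?thesis
      using v(2) by (intro exI[of _ "v @ [x]"]) simp
  qed
qed simp

text \<open>A new letter either extends the reduced word or, by \<open>reduced_topE\<close>, meets
  its inverse at the end of an equivalent word and cancels there.\<close>

lemma ex_reduced: "u \<in> lists (letters n) \<Longrightarrow> \<exists>v. lf_eq n u v \<and> reduced n v"
proof (induction u rule: rev_induct)
  case Nil
  then show ?case
    by (intro exI[of _ "[]"]) (auto simp: reduced_def lf_eq.lf_refl)
next
  case (snoc x u)
  then obtain v where v: "lf_eq n u v" "reduced n v" and x: "x \<in> letters n"
    by auto
  have eq: "lf_eq n (u @ [x]) (v @ [x])"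
    using lf_eq_append[OF v(1) lf_eq.lf_refl[of "[x]"]] x by simp
  show ?case
  proof (cases "inv_letter x \<in> tops (piling_of v)")
    case True
    then obtain v' where v': "lf_eq n v (v' @ [inv_letter x])" "Suc (length v') = length v"
      using reduced_topE[OF v(2)] by blast
    have m: "v' \<in> lists (letters n)"
      using lf_eq_lists[OF v'(1)] by auto
    have "lf_eq n (v @ [x]) (v' @ [inv_letter x, inv_letter (inv_letter x)] @ [])"
      using lf_eq_append[OF v'(1) lf_eq.lf_refl[of "[x]"]] x by simp
    moreover have "lf_eq n (v' @ [inv_letter x, inv_letter (inv_letter x)] @ []) (v' @ [])"
      using m x by (intro lf_eq.lf_cancel) auto
    ultimately have eq': "lf_eq n (v @ [x]) v'"
      by (auto intro: lf_eq.lf_trans)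
    have "psize n (piling_of v') = length v'"
      using piling_of_cong[OF eq'] psize_put(1)[OF x valid_piling_of True] v'(2) v(2)
      by (simp add: reduced_def)
    with m eq eq' show ?thesis
      unfolding reduced_def by (blast intro: lf_eq.lf_trans)
  next
    case False
    with v(2) x eq show ?thesis
      using reduced_snoc by blast
  qed
qed

text \<open>The number of signs is the same for all representatives and bounds the length of each
  from below; a reduced representative attains it.\<close>

lemma K_eq_psize:
  assumes "u \<in> lists (letters n)"
  shows "K n (lf_class n u) = psize n (piling_of u)"
  unfolding K_def
proof (rule Least_equality)
  obtain v where "lf_eq n u v" "reduced n v"
    using ex_reduced[OF assms] by blast
  then show "\<exists>v\<in>lf_class n u. length v = psize n (piling_of u)"
    by (intro bexI[of _ v]) (auto simp: reduced_def dest: piling_of_cong)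
next
  fix k assume "\<exists>v\<in>lf_class n u. length v = k"
  then obtain v where "lf_eq n u v" "length v = k"
    by auto
  then show "psize n (piling_of u) \<le> k"
    using psize_le_length[of v n] piling_of_cong lf_eq_lists by metis
qed

text \<open>A letter on top is the last letter of some representing word, hence belongs to the
  alphabet.\<close>

lemma tops_piling_of:
  assumes "u \<in> lists (letters n)"
  shows "tops (piling_of u) \<subseteq> letters n"
proof
  fix y assume y: "y \<in> tops (piling_of u)"
  obtain v where v: "lf_eq n u v" "reduced n v"
    using ex_reduced[OF assms] by blast
  then obtain w where "lf_eq n v (w @ [y])"
    using reduced_topE[OF v(2), of y] y piling_of_cong[OF v(1)] by auto
  then show "y \<in> letters n"
    using lf_eq_lists by fastforce
qed

lemma K_put_iff:
  assumes "u \<in> lists (letters n)" "x \<in> letters n"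
  shows "K n (lf_class n u \<otimes>\<^bsub>lf_group n\<^esub> lf_letter n x) + 1 = K n (lf_class n u) \<longleftrightarrow>
    inv_letter x \<in> tops (piling_of u)"
proof -
  have "K n (lf_class n u \<otimes>\<^bsub>lf_group n\<^esub> lf_letter n x) = psize n (put (piling_of u) x)"
    using assms by (simp add: lf_mult_class K_eq_psize append_in_lists_conv)
  then show ?thesis
    using psize_put[OF assms(2) valid_piling_of, of u] assms
    by (cases "inv_letter x \<in> tops (piling_of u)") (auto simp: K_eq_psize)
qed

lemma roof_eq:
  assumes "u \<in> lists (letters n)"
  shows "roof n (lf_class n u) = fst ` tops (piling_of u)"
proof -
  have "i \<in> roof n (lf_class n u) \<longleftrightarrow> i \<in> fst ` tops (piling_of u)" for i
  proof (cases "i \<in> {1..n}")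
    case True
    then have m: "(i, b) \<in> letters n" for b
      by (simp add: letters_def)
    have "i \<in> roof n (lf_class n u) \<longleftrightarrow>
        (i, False) \<in> tops (piling_of u) \<or> (i, True) \<in> tops (piling_of u)"
      using True K_put_iff[OF assms m, of True] K_put_iff[OF assms m, of False]
      by (simp add: roof_def inv_letter_def)
    also have "\<dots> \<longleftrightarrow> i \<in> fst ` tops (piling_of u)"
      unfolding Domain_fst[symmetric] Domain_iff ex_bool_eq by blast
    finally show ?thesis .
  next
    case False
    moreover have "fst ` letters n \<subseteq> {1..n}"
      by (auto simp: letters_def)
    ultimately have "i \<notin> fst ` tops (piling_of u)"
      using tops_piling_of[OF assms] by blast
    with False show ?thesis
      by (auto simp: roof_def)
  qed
  then show ?thesis by blast
qed

definition ntops :: "letter list \<Rightarrow> nat" where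
  "ntops u = card (tops (piling_of u))"

lemma card_roof: "u \<in> lists (letters n) \<Longrightarrow> card (roof n (lf_class n u)) = ntops u"
  by (simp add: roof_eq ntops_def card_image inj_on_fst_tops)

section \<open>One step of the walk\<close>

lemma finite_letters [simp]: "finite (letters n)"
  by (simp add: letters_def)

lemma card_letters [simp]: "card (letters n) = 2 * n"
  by (simp add: letters_def card_cartesian_product)

lemma finite_tops: "u \<in> lists (letters n) \<Longrightarrow> finite (tops (piling_of u))"
  using tops_piling_of finite_subset finite_letters by metis

lemma inverse_lists [simp]:
  "rev (map inv_letter u) \<in> lists (letters n) \<longleftrightarrow> u \<in> lists (letters n)"
  by auto

section \<open>Inverse words and projections to sets of generators\<close>

abbreviation inv_word :: "letter list \<Rightarrow> letter list" where
  "inv_word u \<equiv> rev (map inv_letter u)"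

lemma lf_eq_inv_word: "lf_eq n u v \<Longrightarrow> lf_eq n (inv_word u) (inv_word v)"
proof (induction rule: lf_eq.induct)
  case (lf_cancel u v x)
  then show ?case
    using lf_eq.lf_cancel[of "inv_word v" n "inv_word u" x] by simp
next
  case (lf_comm u v j k)
  then have m: "(j, True) \<in> letters n" "(k, True) \<in> letters n"
    by (auto simp: letters_def)
  have "lf_eq n [inv_letter (k, True), inv_letter (j, True)] [inv_letter (j, True), inv_letter (k, True)]"
    using lf_comm m by (intro lf_eq_commute) (auto simp: nbr_def)
  from lf_eq_context[OF this, of "inv_word v" "inv_word u"] lf_comm show ?case
    by simp
next
  case (lf_refl u)
  then show ?case
    by (intro lf_eq.lf_refl) simp
qed (blast intro: lf_eq.lf_sym lf_eq.lf_trans)+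

text \<open>Killing the generators outside \<open>S\<close> turns each relation into a relation or a
  trivial equality, so it is a well-defined homomorphism. It is needed for
  \<open>pair_proj\<close>.\<close>

lemma lf_eq_filter:
  "lf_eq n u v \<Longrightarrow> lf_eq n (filter (\<lambda>x. fst x \<in> S) u) (filter (\<lambda>x. fst x \<in> S) v)"
proof (induction rule: lf_eq.induct)
  case (lf_cancel u v x)
  then have "filter (\<lambda>x. fst x \<in> S) u \<in> lists (letters n)" "filter (\<lambda>x. fst x \<in> S) v \<in> lists (letters n)"
    by auto
  with lf_cancel(3) show ?case
    by (cases "fst x \<in> S") (auto simp: lf_eq.lf_cancel[simplified] lf_eq.lf_refl)
next
  case (lf_comm u v j k)
  then have "filter (\<lambda>x. fst x \<in> S) u \<in> lists (letters n)" "filter (\<lambda>x. fst x \<in> S) v \<in> lists (letters n)"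
    "(j, True) \<in> letters n" "(k, True) \<in> letters n"
    by (auto simp: letters_def)
  with lf_comm(3-) show ?case
    by (cases "j \<in> S"; cases "k \<in> S") (simp_all add: lf_eq.lf_comm[simplified] lf_eq.lf_refl)
next
  case (lf_refl u)
  then show ?case
    by (intro lf_eq.lf_refl) auto
qed (blast intro: lf_eq.lf_sym lf_eq.lf_trans)+

section \<open>Change of the roof under right multiplication\<close>

lemma tops_put_increase_same:
  assumes "valid p" "x \<in> tops p"
  shows "tops (put p x) = tops p"
proof -
  have "inv_letter x \<notin> tops p"
    using tops_unique[OF assms(2), of "inv_letter x"] by auto
  then show ?thesis
    using assms valid_not_nbr[OF assms(1) _ assms(2)] tops_unique[of _ p x]
    by (auto simp: put_def tops_push)
qed

lemma card_tops_push:
  assumes "finite (tops p)" "fst x \<notin> fst ` tops p"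
  shows "real (card (tops (push x p))) =
    real (card (tops p)) + 1 - real (card {y \<in> tops p. nbr (fst y) (fst x)})"
proof -
  have "tops (push x p) = insert x (tops p - {y \<in> tops p. nbr (fst y) (fst x)})"
    using assms(2) by (force simp: tops_push image_iff)
  moreover have "x \<notin> tops p"
    using assms(2) by auto
  ultimately have "card (tops (push x p)) = Suc (card (tops p) - card {y \<in> tops p. nbr (fst y) (fst x)})"
    using assms(1) by (simp add: card_Diff_subset)
  moreover have "card {y \<in> tops p. nbr (fst y) (fst x)} \<le> card (tops p)"
    using assms(1) by (intro card_mono) auto
  ultimately show ?thesis
    by simp
qed

lemma card_nbr_tops:
  "card {y \<in> tops p. nbr (fst y) i} = card {j \<in> fst ` tops p. nbr j i}"
proof -
  have "{j \<in> fst ` tops p. nbr j i} = fst ` {y \<in> tops p. nbr (fst y) i}"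
    by auto
  moreover have "inj_on fst {y \<in> tops p. nbr (fst y) i}"
    using inj_on_fst_tops by (rule inj_on_subset) auto
  ultimately show ?thesis
    by (simp add: card_image)
qed

lemma card_nbr_tops_le: "card {y \<in> tops p. nbr (fst y) i} \<le> 2"
proof -
  have "card {j \<in> fst ` tops p. nbr j i} \<le> card {i - 1, Suc i}"
    by (intro card_mono) (auto simp: nbr_def)
  also have "\<dots> \<le> 2"
    by (simp add: card_insert_if)
  finally show ?thesis
    by (simp add: card_nbr_tops)
qed

text \<open>Read the step backwards: \<open>p\<close> arises from the shorter \<open>q\<close> by a
  push, which either leaves the roof unchanged or adds one top and covers at most two adjacent
  ones.\<close>

lemma tops_put_decrease:
  assumes "valid p" "finite (tops p)" "inv_letter x \<in> tops p"
  shows "card (tops (put p x)) = card (tops p) \<or> card (tops (put p x)) = card (tops p) + 1 \<or>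
    card (tops (put p x)) + 1 = card (tops p)"
proof -
  obtain q where q: "valid q" "p = push (inv_letter x) q" "inv_letter (inv_letter x) \<notin> tops q"
    using valid_topE[OF assms(1,3)] by blast
  have p: "put p x = q"
    using assms(3) pop_push[of "inv_letter x" q] by (simp add: put_def q(2))
  show ?thesis
  proof (cases "inv_letter x \<in> tops q")
    case True
    have "put q (inv_letter x) = p"
      using q by (simp add: put_def)
    then have "tops p = tops q"
      using tops_put_increase_same[OF q(1) True] by simp
    then show ?thesis
      by (simp add: p)
  next
    case False
    have fst: "fst (inv_letter x) \<notin> fst ` tops q"
    proof
      assume "fst (inv_letter x) \<in> fst ` tops q"
      then obtain y where "y \<in> tops q" "fst y = fst x"
        by auto
      then show False
        using letter_cases[of y x] False q(3) by auto
    qed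
    have "tops q \<subseteq> tops p \<union> {y \<in> tops q. nbr (fst y) (fst x)}"
      using fst by (force simp: q(2) tops_push image_iff)
    moreover have "finite {y \<in> tops q. nbr (fst y) (fst x)}"
    proof -
      have "fst ` {y \<in> tops q. nbr (fst y) (fst x)} \<subseteq> {fst x - 1, Suc (fst x)}"
        by (auto simp: nbr_def)
      then have "finite (fst ` {y \<in> tops q. nbr (fst y) (fst x)})"
        by (rule finite_subset) simp
      moreover have "inj_on fst {y \<in> tops q. nbr (fst y) (fst x)}"
        using inj_on_fst_tops by (rule inj_on_subset) auto
      ultimately show ?thesis
        by (rule finite_imageD)
    qed
    ultimately have "finite (tops q)"
      using assms(2) finite_subset by blast
    then have "real (card (tops p)) =
        real (card (tops q)) + 1 - real (card {y \<in> tops q. nbr (fst y) (fst x)})"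
      using card_tops_push[OF _ fst] by (simp add: q(2))
    then show ?thesis
      using card_nbr_tops_le[of q "fst x"] unfolding p by linarith
  qed
qed

text \<open>Double counting of adjacent pairs: every index has two neighbours in the range, except
  that each end of the range loses one. This costs at most 2 in total.\<close>

lemma sum_card_nbr_bounds:
  assumes "T \<subseteq> {1..n}"
  shows "(\<Sum>i=1..n. card {j \<in> T. nbr j i}) \<le> 2 * card T"
    and "2 * card T \<le> (\<Sum>i=1..n. card {j \<in> T. nbr j i}) + 2"
proof -
  have fin: "finite T"
    using assms finite_subset by blast
  have "(\<Sum>i=1..n. card {j \<in> T. nbr j i}) = (\<Sum>i=1..n. \<Sum>j\<in>T. of_bool (nbr j i))"
    using fin by (simp add: Int_def)
  also have "\<dots> = (\<Sum>j\<in>T. \<Sum>i=1..n. of_bool (nbr j i))"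
    by (rule sum.swap)
  also have "\<dots> = (\<Sum>j\<in>T. card {i \<in> {1..n}. nbr j i})"
    by (simp add: Int_def)
  finally have eq: "(\<Sum>i=1..n. card {j \<in> T. nbr j i}) = (\<Sum>j\<in>T. card {i \<in> {1..n}. nbr j i})" .
  have le: "card {i \<in> {1..n}. nbr j i} \<le> 2" for j
  proof -
    have "card {i \<in> {1..n}. nbr j i} \<le> card {j - 1, Suc j}"
      by (intro card_mono) (auto simp: nbr_def)
    also have "\<dots> \<le> 2"
      by (simp add: card_insert_if)
    finally show ?thesis .
  qed
  show "(\<Sum>i=1..n. card {j \<in> T. nbr j i}) \<le> 2 * card T"
    unfolding eq using sum_bounded_above[of T "\<lambda>j. card {i \<in> {1..n}. nbr j i}" 2] le by simp
  have ge: "2 \<le> card {i \<in> {1..n}. nbr j i} + of_bool (j = 1) + of_bool (j = n)" if "j \<in> T" for j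
  proof -
    have j: "1 \<le> j" "j \<le> n"
      using assms that by auto
    consider "j = 1" "j = n" | "j = 1" "j < n" | "1 < j" "j = n" | "1 < j" "j < n"
      using j by linarith
    then show ?thesis
    proof cases
      case 2
      then have "card {2::nat} \<le> card {i \<in> {1..n}. nbr j i}"
        by (intro card_mono) (auto simp: nbr_def)
      with 2 show ?thesis by simp
    next
      case 3
      then have "card {j - 1} \<le> card {i \<in> {1..n}. nbr j i}"
        by (intro card_mono) (auto simp: nbr_def)
      with 3 show ?thesis by simp
    next
      case 4
      then have "card {j - 1, Suc j} \<le> card {i \<in> {1..n}. nbr j i}"
        by (intro card_mono) (auto simp: nbr_def)
      with 4 show ?thesis by simp
    qed simp
  qed
  have "2 * card T \<le> (\<Sum>j\<in>T. card {i \<in> {1..n}. nbr j i} + of_bool (j = 1) + of_bool (j = n))"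
    using sum_mono[of T "\<lambda>_. 2" "\<lambda>j. card {i \<in> {1..n}. nbr j i} + of_bool (j = 1) + of_bool (j = n)", OF ge]
    by simp
  also have "\<dots> = (\<Sum>j\<in>T. card {i \<in> {1..n}. nbr j i}) + card (T \<inter> {1}) + card (T \<inter> {n})"
    using fin by (simp add: sum.distrib)
  also have "\<dots> \<le> (\<Sum>j\<in>T. card {i \<in> {1..n}. nbr j i}) + 1 + 1"
    using card_mono[of "{1}" "T \<inter> {1}"] card_mono[of "{n}" "T \<inter> {n}"] by simp
  finally show "2 * card T \<le> (\<Sum>i=1..n. card {j \<in> T. nbr j i}) + 2"
    unfolding eq by simp
qed

text \<open>Repeating a top letter changes nothing, so only indices off the roof \<open>T\<close>
  count, with two letters each and change \<open>1 - c i\<close>. Roof indices have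
  \<open>c i = 0\<close>, hence the sum is \<open>2 * (n - sum of c - card T)\<close>. The sum of
  \<open>c\<close> is \<open>2 * card T\<close> up to 2, whence the error 4.\<close>

lemma sum_ntops_increase:
  assumes u: "u \<in> lists (letters n)"
  shows "\<bar>(\<Sum>x\<in>{x \<in> letters n. inv_letter x \<notin> tops (piling_of u)}. real (ntops (u @ [x])) - real (ntops u))
    - (2 * real n - 6 * real (ntops u))\<bar> \<le> 4"
proof -
  let ?p = "piling_of u"
  define T where "T = fst ` tops ?p"
  define c where "c i = card {j \<in> T. nbr j i}" for i
  let ?d = "\<lambda>x. real (ntops (u @ [x])) - real (ntops u)"
  have T: "T \<subseteq> {1..n}"
    using tops_piling_of[OF u] by (auto simp: T_def letters_def)
  have fin: "finite (tops ?p)"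
    using finite_tops[OF u] .
  have card_T: "card T = ntops u"
    by (simp add: T_def ntops_def card_image inj_on_fst_tops)
  have "(\<Sum>x\<in>{x \<in> letters n. inv_letter x \<notin> tops ?p}. ?d x) = (\<Sum>x\<in>({1..n} - T) \<times> (UNIV :: bool set). 1 - real (c (fst x)))"
  proof (rule sum.mono_neutral_cong_right)
    show "({1..n} - T) \<times> UNIV \<subseteq> {x \<in> letters n. inv_letter x \<notin> tops ?p}"
    proof
      fix x assume "x \<in> ({1..n} - T) \<times> (UNIV :: bool set)"
      then have "fst x \<in> {1..n}" "fst x \<notin> fst ` tops ?p"
        by (simp_all add: T_def mem_Times_iff)
      then show "x \<in> {x \<in> letters n. inv_letter x \<notin> tops ?p}"
        by (metis (mono_tags, lifting) SigmaI UNIV_I fst_inv_letter image_eqI letters_def mem_Collect_eq prod.collapse)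
    qed
    show "\<forall>x\<in>{x \<in> letters n. inv_letter x \<notin> tops ?p} - ({1..n} - T) \<times> UNIV. ?d x = 0"
    proof
      fix x assume x: "x \<in> {x \<in> letters n. inv_letter x \<notin> tops ?p} - ({1..n} - T) \<times> UNIV"
      then have "fst x \<in> T"
        by (cases x) (auto simp: letters_def)
      then obtain y where "y \<in> tops ?p" "fst y = fst x"
        by (auto simp: T_def)
      then have "x \<in> tops ?p"
        using letter_cases[of y x] x by auto
      then show "?d x = 0"
        using tops_put_increase_same[OF valid_piling_of] by (simp add: ntops_def)
    qed
    fix x assume "x \<in> ({1..n} - T) \<times> (UNIV :: bool set)"
    then have x: "fst x \<notin> fst ` tops ?p"
      by (simp add: T_def mem_Times_iff)
    then have "inv_letter x \<notin> tops ?p"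
      by (metis fst_inv_letter image_eqI)
    then show "?d x = 1 - real (c (fst x))"
      using card_tops_push[OF fin x] by (simp add: ntops_def put_def c_def T_def card_nbr_tops)
  qed auto
  also have "\<dots> = 2 * (\<Sum>i\<in>{1..n} - T. 1 - real (c i))"
    by (simp add: sum.cartesian_product' sum_distrib_left)
  also have "(\<Sum>i\<in>{1..n} - T. 1 - real (c i)) = (\<Sum>i\<in>{1..n}. 1 - real (c i)) - (\<Sum>i\<in>T. 1 - real (c i))"
    using T by (intro sum_diff) auto
  also have "(\<Sum>i\<in>T. 1 - real (c i)) = (\<Sum>i\<in>T. 1)"
  proof (rule sum.cong)
    fix i assume "i \<in> T"
    then have "{j \<in> T. nbr j i} = {}"
      using valid_not_nbr[OF valid_piling_of, of _ u] by (auto simp: T_def)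
    then have "c i = 0"
      unfolding c_def by (metis card.empty)
    then show "1 - real (c i) = 1"
      by simp
  qed simp
  finally have "(\<Sum>x\<in>{x \<in> letters n. inv_letter x \<notin> tops ?p}. ?d x) =
      2 * (real n - real (\<Sum>i=1..n. c i) - real (ntops u))"
    by (simp add: sum_subtractf card_T)
  moreover have "(\<Sum>i=1..n. c i) \<le> 2 * ntops u" "2 * ntops u \<le> (\<Sum>i=1..n. c i) + 2"
    using sum_card_nbr_bounds[OF T] by (simp_all add: c_def card_T)
  then have "real (\<Sum>i=1..n. c i) \<le> 2 * real (ntops u)"
    "2 * real (ntops u) \<le> real (\<Sum>i=1..n. c i) + 2"
    by linarith+
  ultimately show ?thesis
    unfolding abs_le_iff by (simp add: algebra_simps del: of_nat_sum)
qed

lemma cond_prob_step: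
  assumes "n \<ge> 1"
  shows "cond_prob (measure_pmf (step n)) P Q =
    real (card {x \<in> letters n. P x \<and> Q x}) / real (card {x \<in> letters n. Q x})"
proof -
  have ne: "letters n \<noteq> {}"
    using assms by (auto simp: letters_def)
  show ?thesis
    using assms measure_pmf_of_set[OF ne finite_letters, of "{x. P x \<and> Q x}"]
      measure_pmf_of_set[OF ne finite_letters, of "{x. Q x}"]
    by (simp add: cond_prob_def step_def Int_def)
qed

text \<open>Exactly \<open>ntops u\<close> letters shorten \<open>u\<close>, so multiplying the
  conditional probabilities by \<open>ntops u\<close> recovers the numbers of letters that raise or
  lower the roof size by one.\<close>

lemma sum_ntops_decrease:
  assumes u: "u \<in> lists (letters n)" and n: "n \<ge> 1"
  shows "(\<Sum>x\<in>{x \<in> letters n. inv_letter x \<in> tops (piling_of u)}. real (ntops (u @ [x])) - real (ntops u))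
    = real (ntops u) * (p_plus_at n (lf_class n u) - p_minus_at n (lf_class n u))"
proof -
  let ?D = "{x \<in> letters n. inv_letter x \<in> tops (piling_of u)}"
  let ?P = "{x \<in> letters n. ntops (u @ [x]) = ntops u + 1 \<and> inv_letter x \<in> tops (piling_of u)}"
  let ?M = "{x \<in> letters n. ntops (u @ [x]) + 1 = ntops u \<and> inv_letter x \<in> tops (piling_of u)}"
  let ?d = "\<lambda>x. real (ntops (u @ [x])) - real (ntops u)"
  have "?D = inv_letter ` tops (piling_of u)"
    using tops_piling_of[OF u] by (force simp: image_iff)
  then have D: "card ?D = ntops u"
    by (simp add: ntops_def card_image inj_on_inverseI[of _ inv_letter])
  have K: "K n (lf_class n u \<otimes>\<^bsub>lf_group n\<^esub> lf_letter n x) + 1 = K n (lf_class n u)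
      \<longleftrightarrow> inv_letter x \<in> tops (piling_of u)"
    and R: "card (roof n (lf_class n u \<otimes>\<^bsub>lf_group n\<^esub> lf_letter n x)) = ntops (u @ [x])"
    if "x \<in> letters n" for x
    using that u by (simp_all only: K_put_iff) (simp add: lf_mult_class card_roof append_in_lists_conv)
  have "p_plus_at n (lf_class n u) = real (card ?P) / real (card ?D)"
    unfolding p_plus_at_def cond_prob_step[OF n]
    using K R card_roof[OF u] by (simp cong: conj_cong del: One_nat_def add_Suc_right)
  moreover have "p_minus_at n (lf_class n u) = real (card ?M) / real (card ?D)"
    unfolding p_minus_at_def cond_prob_step[OF n]
    using K R card_roof[OF u] by (simp cong: conj_cong del: One_nat_def add_Suc_right)
  moreover have "card ?P \<le> card ?D" "card ?M \<le> card ?D"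
    by (auto intro!: card_mono)
  ultimately have "real (ntops u) * (p_plus_at n (lf_class n u) - p_minus_at n (lf_class n u))
      = real (card ?P) - real (card ?M)"
    \<comment> \<open>For an empty roof the quotients have denominator 0, and the bounds just proved
      make both counts vanish.\<close>
    by (cases "ntops u = 0") (simp_all add: D right_diff_distrib)
  also have "\<dots> = (\<Sum>x\<in>?D. of_bool (ntops (u @ [x]) = ntops u + 1) - of_bool (ntops (u @ [x]) + 1 = ntops u))"
  proof -
    have "?D \<inter> {x. ntops (u @ [x]) = ntops u + 1} = ?P" "?D \<inter> {x. ntops (u @ [x]) + 1 = ntops u} = ?M"
      by auto
    then show ?thesis
      by (simp add: sum_subtractf)
  qed
  also have "\<dots> = (\<Sum>x\<in>?D. ?d x)"
  proof (rule sum.cong)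
    fix x assume "x \<in> ?D"
    then show "of_bool (ntops (u @ [x]) = ntops u + 1) - of_bool (ntops (u @ [x]) + 1 = ntops u) = ?d x"
      using tops_put_decrease[OF valid_piling_of finite_tops[OF u], of x] by (auto simp: ntops_def)
  qed simp
  finally show ?thesis by simp
qed

lemma sum_ntops_step:
  assumes u: "u \<in> lists (letters n)" and n: "n \<ge> 1"
  shows "\<bar>(\<Sum>x\<in>letters n. real (ntops (u @ [x])) - real (ntops u)) -
    (2 * real n - 6 * real (ntops u) +
     real (ntops u) * (p_plus_at n (lf_class n u) - p_minus_at n (lf_class n u)))\<bar> \<le> 4"
proof -
  let ?d = "\<lambda>x. real (ntops (u @ [x])) - real (ntops u)"
  have "(\<Sum>x\<in>letters n. ?d x) = (\<Sum>x\<in>{x \<in> letters n. inv_letter x \<notin> tops (piling_of u)}. ?d x) +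
     (\<Sum>x\<in>{x \<in> letters n. inv_letter x \<in> tops (piling_of u)}. ?d x)"
    by (subst sum.union_disjoint[symmetric]) (auto intro!: sum.cong)
  then show ?thesis
    using sum_ntops_increase[OF u] sum_ntops_decrease[OF u n] by linarith
qed

lemma sum_psize_step:
  assumes u: "u \<in> lists (letters n)"
  shows "(\<Sum>x\<in>letters n. real (psize n (piling_of (u @ [x]))) - real (psize n (piling_of u))) =
    2 * real n - 2 * real (ntops u)"
proof -
  let ?D = "{x \<in> letters n. inv_letter x \<in> tops (piling_of u)}"
  have "?D = inv_letter ` tops (piling_of u)"
    using tops_piling_of[OF u] by (force simp: image_iff)
  then have D: "card ?D = ntops u"
    by (simp add: ntops_def card_image inj_on_inverseI[of _ inv_letter])
  have "real (psize n (piling_of (u @ [x]))) - real (psize n (piling_of u)) =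
      1 - 2 * of_bool (inv_letter x \<in> tops (piling_of u))" if "x \<in> letters n" for x
    using psize_put[OF that valid_piling_of, of u] by (cases "inv_letter x \<in> tops (piling_of u)") auto
  then have "(\<Sum>x\<in>letters n. real (psize n (piling_of (u @ [x]))) - real (psize n (piling_of u))) =
      (\<Sum>x\<in>letters n. 1 - 2 * of_bool (inv_letter x \<in> tops (piling_of u)))"
    by (intro sum.cong) auto
  also have "\<dots> = 2 * real n - 2 * real (card ?D)"
    by (simp add: sum_subtractf sum_distrib_left[symmetric] Int_def)
  finally show ?thesis
    by (simp add: D)
qed

text \<open>Appending letters supported on \<open>A\<close> can change the roof only at \<open>A\<close> and its neighbours.\<close>

lemma ntops_append_diff_le:
  assumes "u \<in> lists (letters n)" "a \<in> lists (letters n)" "fst ` set a \<subseteq> A" "finite A"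
  shows "\<bar>real (ntops (u @ a)) - real (ntops u)\<bar> \<le> 3 * real (card A)"
proof -
  \<comment> \<open>Letters supported on \<open>A\<close> touch only these stacks, at most three per
    index, and each stack shows at most one sign.\<close>
  define B where "B = (\<Union>i\<in>A. {i - 1, i, Suc i})"
  have B: "fst y \<in> B" if "fst y = i \<or> nbr (fst y) i" "i \<in> A" for y :: letter and i
    using that by (auto simp: B_def nbr_def intro!: bexI[of _ i])
  have fin: "finite B"
    using assms(4) by (simp add: B_def)
  have out: "y \<in> tops (piling_of (u @ a)) \<longleftrightarrow> y \<in> tops (piling_of u)" if "fst y \<notin> B" for y
    using assms(3)
  proof (induction a rule: rev_induct)
    case (snoc x a)
    have "y \<in> tops (put (piling_of (u @ a)) x) \<longleftrightarrow> y \<in> tops (piling_of (u @ a))"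
      using B[of y "fst x"] that snoc.prems by (intro tops_put_iff) auto
    with snoc show ?case
      by (simp flip: append_assoc)
  qed simp
  have "card (\<Union>i\<in>A. {i - 1, i, Suc i}) \<le> (\<Sum>i\<in>A. card {i - 1, i, Suc i})"
    using assms(4) by (rule card_UN_le)
  also have "\<dots> \<le> (\<Sum>i\<in>A. 3)"
    by (intro sum_mono) (simp add: card_insert_if)
  finally have card_B: "card B \<le> 3 * card A"
    by (simp add: B_def)
  have inside: "card {y \<in> tops p. fst y \<in> B} \<le> card B" for p
    using inj_on_fst_tops fin by (intro card_inj_on_le[of fst]) (auto intro: inj_on_subset)
  have split: "card (tops p) = card {y \<in> tops p. fst y \<in> B} + card {y \<in> tops p. fst y \<notin> B}"
    if "finite (tops p)" for p
    using that by (subst card_Un_disjoint[symmetric]) (auto intro!: arg_cong[of _ _ card])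
  have "{y \<in> tops (piling_of (u @ a)). fst y \<notin> B} = {y \<in> tops (piling_of u). fst y \<notin> B}"
    using out by blast
  then show ?thesis
    using split[OF finite_tops[of u n]] split[OF finite_tops[of "u @ a" n]] assms(1,2)
      inside[of "piling_of u"] inside[of "piling_of (u @ a)"] card_B
    by (simp add: ntops_def append_in_lists_conv)
qed

section \<open>The floor of an element\<close>

text \<open>Without cancellation the piling is built by pushes alone, so the entries of the first
  letter stay at the bottom and the rest is stacked above them unchanged.\<close>

lemma piling_of_Cons_reduced:
  assumes "reduced n v" "reduced n (x # v)"
  shows "piling_of (x # v) = (\<lambda>j. piling_of v j @ push x (\<lambda>_. []) j)"
  using assms
proof (induction v rule: rev_induct)
  case Nil
  then show ?case
    by (simp add: piling_of_def put_def)
next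
  case (snoc y v)
  then have red: "reduced n v" "inv_letter y \<notin> tops (piling_of v)"
    "reduced n (x # v)" "inv_letter y \<notin> tops (piling_of (x # v))"
    using reduced_snoc[of n "x # v" y] by (auto simp: reduced_snoc)
  then have snoc_eq: "piling_of (v @ [y]) = push y (piling_of v)"
    "piling_of (x # v @ [y]) = push y (piling_of (x # v))"
    using piling_of_snoc[of "x # v" y] by (simp_all add: put_def)
  show ?case
    unfolding snoc_eq snoc.IH[OF red(1,3)] by (auto simp: push_def)
qed

lemma reduced_stack_empty:
  assumes "reduced n v" "piling_of v i = []" "y \<in> set v"
  shows "fst y \<noteq> i \<and> \<not> nbr (fst y) i"
  using assms
proof (induction v rule: rev_induct)
  case (snoc x v)
  then have "piling_of (v @ [x]) = push x (piling_of v)"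
    by (auto simp: reduced_snoc put_def)
  with snoc show ?case
    by (auto simp: push_def reduced_snoc nbr_sym split: if_splits)
qed simp

text \<open>Parity rules out an unchanged length when a letter is put in front, as used in
  \<open>ntops_Cons\<close>.\<close>

lemma even_psize: "u \<in> lists (letters n) \<Longrightarrow> even (psize n (piling_of u)) \<longleftrightarrow> even (length u)"
proof (induction u rule: rev_induct)
  case (snoc x u)
  have "even (psize n (put (piling_of u) x)) \<longleftrightarrow> odd (psize n (piling_of u))"
    using psize_put[OF _ valid_piling_of, of x n u] snoc.prems
    by (metis append_in_lists_conv even_Suc listsE)
  with snoc show ?case
    by simp
qed simp

lemma psize_Cons_le:
  assumes "u \<in> lists (letters n)" "x \<in> letters n"
  shows "psize n (piling_of (x # u)) \<le> Suc (psize n (piling_of u))"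
proof -
  obtain v where v: "lf_eq n u v" "reduced n v"
    using ex_reduced[OF assms(1)] by blast
  have "lf_eq n (x # u) (x # v)"
    using lf_eq_context[OF v(1), of "[x]" "[]"] assms(2) by simp
  then have "psize n (piling_of (x # u)) = psize n (piling_of (x # v))"
    by (simp add: piling_of_cong)
  also have "\<dots> \<le> length (x # v)"
    using lf_eq_lists[OF v(1)] assms(2) by (intro psize_le_length) simp
  also have "\<dots> = Suc (psize n (piling_of u))"
    using v piling_of_cong[OF v(1)] by (simp add: reduced_def)
  finally show ?thesis .
qed

text \<open>The roof of \<open>x u\<close> differs from that of \<open>u\<close> only if the remaining letters of a reduced word
  all commute with \<open>x\<close>: in a longer stack the letter \<open>x\<close> only adds an entry at the bottom.\<close>

lemma ntops_Cons_increase: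
  assumes u: "u \<in> lists (letters n)" and x: "x \<in> letters n"
    and inc: "psize n (piling_of (x # u)) = Suc (psize n (piling_of u))"
  shows "\<bar>real (ntops (x # u)) - real (ntops u)\<bar> \<le> 1 \<and> (ntops (x # u) = ntops u \<or>
    (\<exists>v. lf_eq n u v \<and> (\<forall>y\<in>set v. fst y \<noteq> fst x \<and> \<not> nbr (fst y) (fst x))))"
proof -
  obtain v where v: "lf_eq n u v" "reduced n v"
    using ex_reduced[OF u] by blast
  have eq: "lf_eq n (x # u) (x # v)"
    using lf_eq_context[OF v(1), of "[x]" "[]"] x by simp
  have "reduced n (x # v)"
    using v lf_eq_lists[OF eq] piling_of_cong[OF eq] piling_of_cong[OF v(1)] inc
    by (simp add: reduced_def)
  then have p: "piling_of (x # u) = (\<lambda>j. piling_of v j @ push x (\<lambda>_. []) j)"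
    using piling_of_Cons_reduced[OF v(2)] piling_of_cong[OF eq] by simp
  \<comment> \<open>The entries of \<open>x\<close> lie below those of \<open>v\<close>, so they
    show only on stacks that are empty in \<open>v\<close>; the blanks among them add no
    top.\<close>
  have same: "y \<in> tops (piling_of (x # u)) \<longleftrightarrow> y \<in> tops (piling_of u) \<or> (y = x \<and> piling_of v (fst x) = [])"
    for y
    unfolding p piling_of_cong[OF v(1)]
    by (cases "piling_of v (fst y)") (auto simp: tops_def push_def prod_eq_iff)
  show ?thesis
  proof (cases "piling_of v (fst x) = []")
    case True
    then have "tops (piling_of (x # u)) = insert x (tops (piling_of u))"
      using same by blast
    then have "\<bar>real (ntops (x # u)) - real (ntops u)\<bar> \<le> 1"
      using finite_tops[OF u] by (simp add: ntops_def card_insert_if)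
    then show ?thesis
      using reduced_stack_empty[OF v(2) True] v(1) by blast
  next
    case False
    then have "tops (piling_of (x # u)) = tops (piling_of u)"
      using same by blast
    then show ?thesis
      by (simp add: ntops_def)
  qed
qed

text \<open>By parity the length goes up or down by one. If it goes down,
  \<open>ntops_Cons_increase\<close> applies to \<open>inv_letter x\<close> in front of
  \<open>x # u\<close>; this is why the commuting word may represent either element.\<close>

lemma ntops_Cons:
  assumes u: "u \<in> lists (letters n)" and x: "x \<in> letters n"
  shows "\<bar>real (ntops (x # u)) - real (ntops u)\<bar> \<le> 1 \<and> (ntops (x # u) = ntops u \<or>
    (\<exists>v. (lf_eq n u v \<or> lf_eq n (x # u) v) \<and> (\<forall>y\<in>set v. fst y \<noteq> fst x \<and> \<not> nbr (fst y) (fst x))))"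
proof -
  let ?u = "inv_letter x # x # u"
  have cancel: "lf_eq n ?u u"
    using lf_eq.lf_cancel[of "[]" n u "inv_letter x"] u x by simp
  have xu: "x # u \<in> lists (letters n)"
    using u x by simp
  have "psize n (piling_of (x # u)) \<noteq> psize n (piling_of u)"
    using even_psize[OF u] even_psize[OF xu] by auto
  moreover have "psize n (piling_of ?u) = psize n (piling_of u)"
    using piling_of_cong[OF cancel] by simp
  ultimately consider "psize n (piling_of (x # u)) = Suc (psize n (piling_of u))"
    | "psize n (piling_of ?u) = Suc (psize n (piling_of (x # u)))"
    using psize_Cons_le[OF u x] psize_Cons_le[OF xu, of "inv_letter x"] x by force
  then show ?thesis
  proof cases
    case 1
    then show ?thesis
      using ntops_Cons_increase[OF u x] by blast
  next
    case 2
    have "ntops ?u = ntops u"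
      using piling_of_cong[OF cancel] by (simp add: ntops_def)
    then show ?thesis
      using ntops_Cons_increase[OF xu _ 2] x by (auto simp: abs_minus_commute)
  qed
qed

text \<open>The projection of \<open>u\<close> to the free group on \<open>g\<^sub>j\<close> and \<open>g\<^sub>j\<^sub>+\<^sub>1\<close>.\<close>

definition pair_proj :: "nat \<Rightarrow> letter list \<Rightarrow> letter list" where
  "pair_proj j u = filter (\<lambda>x. fst x \<in> {j, Suc j}) u"

text \<open>An exponential Lyapunov function: it equals 1 exactly when the projection is trivial, so
  its mean bounds the probability of that event, and it contracts on average in each step.\<close>

definition pair_weight :: "nat \<Rightarrow> nat \<Rightarrow> letter list \<Rightarrow> real" where
  "pair_weight n j u = (1 / 2) ^ psize n (piling_of (pair_proj j u))"

section \<open>Decay of the pair weight and control of the floor\<close>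

lemma pair_weight_Nil: "pair_weight n j [] = 1"
  by (simp add: pair_weight_def pair_proj_def)

lemma pair_weight_nonneg: "0 \<le> pair_weight n j u"
  by (simp add: pair_weight_def)

lemma pair_proj_cong: "lf_eq n u v \<Longrightarrow> lf_eq n (pair_proj j u) (pair_proj j v)"
  unfolding pair_proj_def by (rule lf_eq_filter)


text \<open>The two stacks are adjacent, so at most one shows a sign and at most one of the four
  relevant letters shortens the projection. The weight then doubles for one letter and halves for
  three, giving at most \<open>7 / 2\<close> in place of 4.\<close>

lemma pair_weight_step:
  assumes u: "u \<in> lists (letters n)" and j: "j \<ge> 1" "Suc j \<le> n"
  shows "(\<Sum>x\<in>letters n. pair_weight n j (u @ [x])) \<le> (2 * real n - 1 / 2) * pair_weight n j u"
proof -
  define S where "S = {j, Suc j} \<times> (UNIV :: bool set)"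
  define p where "p = piling_of (pair_proj j u)"
  define D where "D = {x \<in> S. inv_letter x \<in> tops p}"
  have S: "S \<subseteq> letters n" "card S = 4"
    using j by (auto simp: S_def letters_def card_cartesian_product)
  have fin: "finite S"
    by (simp add: S_def)
  have "card D \<le> Suc 0"
  proof -
    have "x = y" if "x \<in> D" "y \<in> D" for x y
    proof -
      have "\<not> nbr (fst x) (fst y)"
        using valid_not_nbr[OF valid_piling_of, of "inv_letter x" "pair_proj j u" "inv_letter y"] that
        by (simp add: D_def p_def)
      then have "fst x = fst y"
        using that by (auto simp: D_def S_def nbr_def)
      then have "inv_letter x = inv_letter y"
        using that by (intro tops_unique[of _ p]) (auto simp: D_def)
      then show ?thesis
        by (metis inv_letter_inv_letter)
    qed
    then show ?thesis
      using fin by (auto simp: card_le_Suc0_iff_eq D_def)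
  qed
  let ?w = "pair_weight n j u"
  have out: "pair_weight n j (u @ [x]) = ?w" if "x \<in> letters n - S" for x
    using that by (cases x) (auto simp: pair_weight_def pair_proj_def S_def)
  have ins: "pair_weight n j (u @ [x]) = ?w / 2 + 3 / 2 * ?w * of_bool (x \<in> D)" if "x \<in> S" for x
  proof -
    have "pair_weight n j (u @ [x]) = (1 / 2) ^ psize n (put p x)"
      using that by (auto simp: pair_weight_def pair_proj_def S_def p_def)
    moreover have "x \<in> letters n" "valid p"
      using that S valid_piling_of by (auto simp: p_def)
    moreover have "?w = (1 / 2) ^ psize n p"
      by (simp add: pair_weight_def p_def)
    ultimately show ?thesis
      using psize_put[of x n p] that
      by (cases "inv_letter x \<in> tops p") (auto simp: D_def dest!: sym[of "Suc _"])
  qed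
  have "(\<Sum>x\<in>letters n. pair_weight n j (u @ [x])) =
      (\<Sum>x\<in>letters n - S. pair_weight n j (u @ [x])) + (\<Sum>x\<in>S. pair_weight n j (u @ [x]))"
    using S by (intro sum.subset_diff) auto
  also have "(\<Sum>x\<in>letters n - S. pair_weight n j (u @ [x])) = real (card (letters n - S)) * ?w"
    using out by simp
  also have "real (card (letters n - S)) = 2 * real n - 4"
    using S fin j by (simp add: card_Diff_subset)
  also have "(\<Sum>x\<in>S. pair_weight n j (u @ [x])) = (\<Sum>x\<in>S. ?w / 2 + 3 / 2 * ?w * of_bool (x \<in> D))"
    using ins by (intro sum.cong) auto
  also have "\<dots> = 2 * ?w + 3 / 2 * ?w * real (card D)"
  proof -
    have "S \<inter> D = D"
      by (auto simp: D_def)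
    then have "(\<Sum>x\<in>S. of_bool (x \<in> D)) = real (card D)"
      using fin by simp
    then show ?thesis
      using S(2) sum_distrib_left[of "3 / 2 * ?w" "\<lambda>x. of_bool (x \<in> D)" S]
      by (simp add: sum.distrib)
  qed
  also have "3 / 2 * ?w * real (card D) \<le> 3 / 2 * ?w * 1"
    using \<open>card D \<le> Suc 0\<close> by (intro mult_left_mono) (auto simp: pair_weight_nonneg)
  finally show ?thesis
    by (simp add: algebra_simps)
qed

lemma pair_weight_eq_1:
  assumes "lf_eq n u v" "\<forall>y\<in>set v. fst y \<notin> {j, Suc j}"
  shows "pair_weight n j u = 1"
proof -
  have "pair_proj j v = []"
    using assms(2) by (simp add: pair_proj_def)
  then have "piling_of (pair_proj j u) = (\<lambda>_. [])"
    using piling_of_cong[OF pair_proj_cong[OF assms(1), of j]] by simp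
  then show ?thesis
    by (simp add: pair_weight_def)
qed

lemma pair_weight_snoc_le:
  assumes "u \<in> lists (letters n)" "x \<in> letters n"
  shows "pair_weight n j (u @ [x]) \<le> 2 * pair_weight n j u"
proof (cases "fst x \<in> {j, Suc j}")
  case True
  let ?p = "piling_of (pair_proj j u)"
  have "pair_proj j (u @ [x]) = pair_proj j u @ [x]"
    using True by (simp add: pair_proj_def)
  moreover have "psize n ?p \<le> Suc (psize n (put ?p x))"
    using psize_put[OF assms(2) valid_piling_of, of "pair_proj j u"] by linarith
  then have "(1 / 2 :: real) ^ Suc (psize n (put ?p x)) \<le> (1 / 2) ^ psize n ?p"
    by (intro power_decreasing) auto
  ultimately show ?thesis
    by (simp add: pair_weight_def)
next
  case False
  then show ?thesis
    using pair_weight_nonneg[of n j u] by (simp add: pair_weight_def pair_proj_def)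
qed

text \<open>If the roof size of the inverse changes, the element before or after the step is
  represented by letters commuting with and different from \<open>x\<close>, so its pair weight is
  1. One step changes the weight by a factor of at most 2, so the factor 2 covers both
  cases.\<close>

lemma ntops_inv_word_snoc:
  assumes u: "u \<in> lists (letters n)" and x: "x \<in> letters n"
    and j: "{j, Suc j} \<subseteq> {i. i = fst x \<or> nbr i (fst x)}"
  shows "\<bar>real (ntops (inv_word (u @ [x]))) - real (ntops (inv_word u))\<bar> \<le> 2 * pair_weight n j u"
proof (cases "ntops (inv_word (u @ [x])) = ntops (inv_word u)")
  case True
  then show ?thesis
    by (simp add: pair_weight_nonneg)
next
  case False
  have le: "\<bar>real (ntops (inv_word (u @ [x]))) - real (ntops (inv_word u))\<bar> \<le> 1"
    using ntops_Cons[of "inv_word u" n "inv_letter x"] u x by simp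
  obtain v where v: "lf_eq n (inv_word u) v \<or> lf_eq n (inv_word (u @ [x])) v"
    "\<forall>y\<in>set v. fst y \<noteq> fst x \<and> \<not> nbr (fst y) (fst x)"
    using ntops_Cons[of "inv_word u" n "inv_letter x"] u x False by auto
  have v': "\<forall>y\<in>set (inv_word v). fst y \<notin> {j, Suc j}"
    using v(2) j by auto
  have inv: "inv_word (inv_word w) = w" for w
    by (simp add: rev_map o_def)
  from v(1) have "lf_eq n u (inv_word v) \<or> lf_eq n (u @ [x]) (inv_word v)"
    using lf_eq_inv_word[of n "inv_word u" v] lf_eq_inv_word[of n "inv_word (u @ [x])" v]
    unfolding inv by blast
  then have "pair_weight n j u = 1 \<or> pair_weight n j (u @ [x]) = 1"
    using pair_weight_eq_1 v' by blast
  then have "1 \<le> 2 * pair_weight n j u"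
    using pair_weight_snoc_le[OF u x, of j] by auto
  with le show ?thesis
    by linarith
qed

section \<open>Expectations over random words\<close>

text \<open>The transition operator of the walk on words. Its iterates
  \<open>(letter_mean n ^^ j) f u\<close> are the conditional expectations of \<open>f\<close> given
  the prefix \<open>u\<close> with \<open>j\<close> letters still to come; \<open>word_mean\<close>
  starts from the empty word.\<close>

definition letter_mean :: "nat \<Rightarrow> (letter list \<Rightarrow> real) \<Rightarrow> letter list \<Rightarrow> real" where
  "letter_mean n f u = (\<Sum>x\<in>letters n. f (u @ [x])) / (2 * real n)"

definition word_mean :: "nat \<Rightarrow> nat \<Rightarrow> (letter list \<Rightarrow> real) \<Rightarrow> real" where
  "word_mean n N f = (letter_mean n ^^ N) f []"

lemma word_mean_0 [simp]: "word_mean n 0 f = f []"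
  by (simp add: word_mean_def)

lemma word_mean_Suc: "word_mean n (Suc N) f = word_mean n N (letter_mean n f)"
  by (simp add: word_mean_def funpow_swap1)

lemma letter_mean_mono:
  "(\<And>x. x \<in> letters n \<Longrightarrow> f (u @ [x]) \<le> g (u @ [x])) \<Longrightarrow> letter_mean n f u \<le> letter_mean n g u"
  unfolding letter_mean_def by (intro divide_right_mono sum_mono) auto

lemma letter_mean_const [simp]: "n \<ge> 1 \<Longrightarrow> letter_mean n (\<lambda>_. c) u = c"
  by (simp add: letter_mean_def)

lemma letter_mean_add: "letter_mean n (\<lambda>u. f u + g u) = (\<lambda>u. letter_mean n f u + letter_mean n g u)"
  by (simp add: letter_mean_def fun_eq_iff sum.distrib add_divide_distrib)

lemma letter_mean_cmult: "letter_mean n (\<lambda>u. c * f u) = (\<lambda>u. c * letter_mean n f u)"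
  by (simp add: letter_mean_def fun_eq_iff sum_distrib_left)

lemma word_mean_mono:
  "(\<And>u. u \<in> lists (letters n) \<Longrightarrow> f u \<le> g u) \<Longrightarrow> word_mean n N f \<le> word_mean n N g"
proof (induction N arbitrary: f g)
  case (Suc N)
  show ?case
    unfolding word_mean_Suc by (intro Suc.IH letter_mean_mono Suc.prems) simp
qed simp

lemma word_mean_cong:
  "(\<And>u. u \<in> lists (letters n) \<Longrightarrow> f u = g u) \<Longrightarrow> word_mean n N f = word_mean n N g"
  by (intro antisym word_mean_mono) auto

lemma word_mean_const [simp]: "n \<ge> 1 \<Longrightarrow> word_mean n N (\<lambda>_. c) = c"
proof (induction N)
  case (Suc N)
  have "letter_mean n (\<lambda>_. c) = (\<lambda>_. c)"
    using Suc.prems by (intro ext letter_mean_const)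
  with Suc show ?case
    by (simp add: word_mean_Suc)
qed simp

lemma word_mean_add: "word_mean n N (\<lambda>u. f u + g u) = word_mean n N f + word_mean n N g"
  by (induction N arbitrary: f g) (simp_all add: word_mean_Suc letter_mean_add)

lemma word_mean_cmult: "word_mean n N (\<lambda>u. c * f u) = c * word_mean n N f"
  by (induction N arbitrary: f) (simp_all add: word_mean_Suc letter_mean_cmult)

lemma word_mean_diff: "word_mean n N (\<lambda>u. f u - g u) = word_mean n N f - word_mean n N g"
  using word_mean_add[of n N f "\<lambda>u. -1 * g u"] word_mean_cmult[of n N "-1" g] by simp

lemma word_mean_divide: "word_mean n N (\<lambda>u. f u / c) = word_mean n N f / c"
  using word_mean_cmult[of n N "1 / c" f] by simp

lemma word_mean_sum:
  "finite A \<Longrightarrow> word_mean n N (\<lambda>u. \<Sum>x\<in>A. g x u) = (\<Sum>x\<in>A. word_mean n N (g x))"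
proof (induction A rule: finite_induct)
  case empty
  show ?case
    using word_mean_cmult[of n N 0 "\<lambda>_. 0"] by simp
qed (simp add: word_mean_add)

lemma abs_word_mean_le: "\<bar>word_mean n N f\<bar> \<le> word_mean n N (\<lambda>u. \<bar>f u\<bar>)"
proof -
  have "word_mean n N f \<le> word_mean n N (\<lambda>u. \<bar>f u\<bar>)"
    by (intro word_mean_mono) auto
  moreover have "- word_mean n N f \<le> word_mean n N (\<lambda>u. \<bar>f u\<bar>)"
    unfolding word_mean_cmult[of n N "-1" f, simplified, symmetric] by (intro word_mean_mono) auto
  ultimately show ?thesis
    by linarith
qed

text \<open>The letters are independent and identically distributed, so one may average over the
  first letter last instead of over the last letter first.\<close>

lemma word_mean_Suc_Cons:
  "word_mean n (Suc N) f = (\<Sum>x\<in>letters n. word_mean n N (\<lambda>u. f (x # u))) / (2 * real n)"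
proof (induction N arbitrary: f)
  case 0
  show ?case
    by (simp add: word_mean_Suc letter_mean_def)
next
  case (Suc N)
  have "(\<lambda>u. letter_mean n f (x # u)) = letter_mean n (\<lambda>u. f (x # u))" for x
    by (simp add: letter_mean_def fun_eq_iff)
  then have "word_mean n (Suc N) (letter_mean n f) =
      (\<Sum>x\<in>letters n. word_mean n N (letter_mean n (\<lambda>u. f (x # u)))) / (2 * real n)"
    using Suc.IH[of "letter_mean n f"] by simp
  then show ?case
    by (simp only: word_mean_Suc)
qed

text \<open>Reversing the order and inverting each letter preserve the uniform law on words of
  length \<open>N\<close>. The induction plays the recursion at the last letter against the one at
  the first.\<close>

lemma word_mean_inv_word: "word_mean n N (\<lambda>u. f (inv_word u)) = word_mean n N f"
proof (induction N arbitrary: f)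
  case (Suc N)
  have "letter_mean n (\<lambda>u. f (inv_word u)) = (\<lambda>u. (\<Sum>x\<in>letters n. f (x # inv_word u)) / (2 * real n))"
    unfolding letter_mean_def
    by (intro ext arg_cong2[of _ _ _ _ "(/)"] sum.reindex_bij_witness[of _ inv_letter inv_letter]) auto
  then have "word_mean n (Suc N) (\<lambda>u. f (inv_word u)) =
      (\<Sum>x\<in>letters n. word_mean n N (\<lambda>u. f (x # inv_word u))) / (2 * real n)"
    by (simp add: word_mean_Suc word_mean_divide word_mean_sum)
  also have "\<dots> = word_mean n (Suc N) f"
    unfolding word_mean_Suc_Cons using Suc.IH[of "\<lambda>u. f (_ # u)"] by simp
  finally show ?case .
qed simp

section \<open>The law of the walk as an average over words, and the influence of single
  letters\<close>

lemma finite_set_pmf_walk: "n \<ge> 1 \<Longrightarrow> finite (set_pmf (walk n N))"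
proof (induction N)
  case (Suc N)
  moreover have "letters n \<noteq> {}"
    using Suc.prems by (auto simp: letters_def)
  ultimately show ?case
    by (simp add: step_def)
qed simp

lemma walk_mean_Suc:
  assumes "n \<ge> 1"
  shows "walk_mean n f (Suc N) =
    walk_mean n (\<lambda>w. (\<Sum>x\<in>letters n. f (w \<otimes>\<^bsub>lf_group n\<^esub> lf_letter n x)) / (2 * real n)) N"
proof -
  have ne: "letters n \<noteq> {}"
    using assms by (auto simp: letters_def)
  show ?thesis
    unfolding walk_mean_def walk.simps
    by (subst pmf_expectation_bind[OF finite_set_pmf_walk[OF assms] _ subset_refl])
      (use ne in \<open>simp_all add: step_def integral_pmf_of_set
          integral_measure_pmf[OF finite_set_pmf_walk[OF assms]] sum_divide_distrib\<close>)
qed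

lemma walk_mean_eq_word_mean:
  assumes "n \<ge> 1"
  shows "walk_mean n f N = word_mean n N (\<lambda>u. f (lf_class n u))"
proof (induction N arbitrary: f)
  case 0
  show ?case
    by (simp add: walk_mean_def lf_one)
next
  case (Suc N)
  show ?case
    unfolding walk_mean_Suc[OF assms] Suc.IH word_mean_Suc
    by (intro word_mean_cong) (simp add: letter_mean_def lf_mult_class)
qed

lemma letter_mean_lf_eq:
  assumes "\<And>u v. lf_eq n u v \<Longrightarrow> f u = f v" "lf_eq n u v"
  shows "(letter_mean n ^^ j) f u = (letter_mean n ^^ j) f v"
  using assms(2)
proof (induction j arbitrary: u v)
  case (Suc j)
  have "lf_eq n (u @ [x]) (v @ [x])" if "x \<in> letters n" for x
    using lf_eq_append[OF Suc.prems lf_eq.lf_refl[of "[x]"]] that by simp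
  then have "letter_mean n ((letter_mean n ^^ j) f) u = letter_mean n ((letter_mean n ^^ j) f) v"
    unfolding letter_mean_def[of _ _ u] letter_mean_def[of _ _ v]
    by (intro arg_cong2[of _ _ _ _ "(/)"] sum.cong Suc.IH) auto
  then show ?case
    by simp
qed (use assms in auto)

text \<open>Information spreads at bounded speed: if \<open>a\<close> is supported on \<open>A\<close>, then \<open>u a x\<close> is
  \<open>u x (x\<^sup>-\<^sup>1 a x)\<close>, and conjugation by \<open>x\<close> enlarges \<open>A\<close> only if \<open>x\<close> is adjacent to \<open>A\<close>, which has
  probability at most \<open>2 |A| / n\<close>.\<close>

lemma letter_mean_append_diff_le:
  assumes n: "n \<ge> 1" and C: "C \<ge> 0"
    and inv: "\<And>u v. lf_eq n u v \<Longrightarrow> f u = f v"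
    and lip: "\<And>u a A. \<lbrakk>u \<in> lists (letters n); a \<in> lists (letters n); fst ` set a \<subseteq> A; finite A\<rbrakk> \<Longrightarrow>
      \<bar>f (u @ a) - f u\<bar> \<le> C * real (card A)"
    and "u \<in> lists (letters n)" "a \<in> lists (letters n)" "fst ` set a \<subseteq> A" "finite A"
  shows "\<bar>(letter_mean n ^^ j) f (u @ a) - (letter_mean n ^^ j) f u\<bar> \<le>
    C * (1 + 2 / real n) ^ j * real (card A)"
  using assms(5-)
proof (induction j arbitrary: u a A)
  case 0
  then show ?case
    using lip by simp
next
  case (Suc j)
  let ?g = "(letter_mean n ^^ j) f"
  define c where "c = C * (1 + 2 / real n) ^ j"
  have c: "0 \<le> c"
    using C by (simp add: c_def)
  have inv_g: "?g v = ?g w" if "lf_eq n v w" for v w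
    using letter_mean_lf_eq[of n f v w j] inv that by blast
  define B where "B = (\<Union>k\<in>A. {k - 1, Suc k}) - A"
  have "card B \<le> card (\<Union>k\<in>A. {k - 1, Suc k})"
    unfolding B_def using Suc.prems(4) by (intro card_mono) auto
  also have "\<dots> \<le> (\<Sum>k\<in>A. card {k - 1, Suc k})"
    using Suc.prems(4) by (rule card_UN_le)
  also have "\<dots> \<le> (\<Sum>k\<in>A. 2)"
    by (intro sum_mono) (simp add: card_insert_if)
  finally have card_B: "card B \<le> 2 * card A"
    by simp
  have fin_B: "finite B"
    using Suc.prems(4) by (simp add: B_def)
  have bound: "\<bar>?g (u @ a @ [x]) - ?g (u @ [x])\<bar> \<le> c * (real (card A) + of_bool (fst x \<in> B))"
    if x: "x \<in> letters n" for x
  proof -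
    have ux: "u @ [x] \<in> lists (letters n)"
      using Suc.prems x by simp
    have conj: "lf_eq n (u @ a @ [x]) ((u @ [x]) @ ([inv_letter x] @ a @ [x]))"
      using lf_eq.lf_sym[OF lf_eq.lf_cancel[of u n "a @ [x]" x]] Suc.prems x by simp
    consider "fst x \<in> A" | "fst x \<in> B" | "fst x \<notin> A" "fst x \<notin> B"
      by blast
    then show ?thesis
    proof cases
      case 1
      have "\<bar>?g ((u @ [x]) @ ([inv_letter x] @ a @ [x])) - ?g (u @ [x])\<bar> \<le> c * real (card A)"
        unfolding c_def using 1 Suc.prems x by (intro Suc.IH ux) auto
      then show ?thesis
        using inv_g[OF conj] 1 by (simp add: B_def)
    next
      case 2
      have "\<bar>?g ((u @ [x]) @ ([inv_letter x] @ a @ [x])) - ?g (u @ [x])\<bar> \<le>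
          c * real (card (insert (fst x) A))"
        unfolding c_def using Suc.prems x by (intro Suc.IH ux) auto
      also have "card (insert (fst x) A) = card A + 1"
        using 2 Suc.prems(4) by (simp add: B_def)
      finally show ?thesis
        using inv_g[OF conj] 2 by (simp add: add.commute)
    next
      case 3
      have "fst x \<noteq> fst y \<and> \<not> nbr (fst x) (fst y)" if "y \<in> set a" for y
      proof -
        have y: "fst y \<in> A"
          using that Suc.prems(3) by auto
        then have "fst x \<noteq> fst y - 1" "fst x \<noteq> Suc (fst y)"
          using 3 by (auto simp: B_def)
        then show ?thesis
          using y 3(1) by (auto simp: nbr_def)
      qed
      then have "lf_eq n (a @ [x]) (x # a)"
        using Suc.prems(2) x by (intro lf_eq_commute_word) auto
      from lf_eq_context[OF this, of u "[]"] have "lf_eq n (u @ a @ [x]) ((u @ [x]) @ a)"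
        using Suc.prems(1) by simp
      moreover have "\<bar>?g ((u @ [x]) @ a) - ?g (u @ [x])\<bar> \<le> c * real (card A)"
        unfolding c_def using Suc.prems by (intro Suc.IH ux) auto
      ultimately show ?thesis
        using inv_g[of "u @ a @ [x]" "(u @ [x]) @ a"] 3 by simp
    qed
  qed
  have "{x \<in> letters n. fst x \<in> B} \<subseteq> B \<times> UNIV"
    by auto
  then have "card {x \<in> letters n. fst x \<in> B} \<le> card (B \<times> (UNIV :: bool set))"
    using fin_B by (intro card_mono) auto
  then have card_x: "real (card {x \<in> letters n. fst x \<in> B}) \<le> 4 * real (card A)"
    using card_B by (simp add: card_cartesian_product)
  have "\<bar>letter_mean n ?g (u @ a) - letter_mean n ?g u\<bar> =
      \<bar>\<Sum>x\<in>letters n. ?g (u @ a @ [x]) - ?g (u @ [x])\<bar> / (2 * real n)"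
    by (simp add: letter_mean_def sum_subtractf diff_divide_distrib[symmetric])
  also have "\<dots> \<le> (\<Sum>x\<in>letters n. c * (real (card A) + of_bool (fst x \<in> B))) / (2 * real n)"
    using bound by (intro divide_right_mono order_trans[OF sum_abs] sum_mono) auto
  also have "(\<Sum>x\<in>letters n. c * (real (card A) + of_bool (fst x \<in> B))) =
      c * (2 * real n * real (card A) + real (card {x \<in> letters n. fst x \<in> B}))"
    by (simp add: sum_distrib_left[symmetric] sum.distrib Int_def)
  also have "\<dots> / (2 * real n) \<le> c * (2 * real n * real (card A) + 4 * real (card A)) / (2 * real n)"
    using c card_x by (intro divide_right_mono mult_left_mono) auto
  \<comment> \<open>At most \<open>2 * card A\<close> adjacent indices with two letters each, out of
    \<open>2 * n\<close> letters, give the growth factor \<open>1 + 2 / n\<close>.\<close>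
  also have "\<dots> = C * (1 + 2 / real n) ^ Suc j * real (card A)"
    using n by (simp add: c_def field_simps)
  finally show ?case
    by simp
qed

text \<open>Decomposition of the variance over the steps: each letter moves the conditional
  expectation by at most \<open>L\<close> and so contributes at most the square of
  \<open>L\<close>.\<close>

lemma letter_mean_variance_le:
  assumes n: "n \<ge> 1"
    and L: "\<And>j x u. \<lbrakk>j < N; u \<in> lists (letters n); x \<in> letters n\<rbrakk> \<Longrightarrow>
      \<bar>(letter_mean n ^^ j) f (u @ [x]) - (letter_mean n ^^ j) f u\<bar> \<le> L"
    and u: "u \<in> lists (letters n)"
  shows "(letter_mean n ^^ N) (\<lambda>u. (f u)\<^sup>2) u - ((letter_mean n ^^ N) f u)\<^sup>2 \<le> real N * L\<^sup>2"
  using L u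
proof (induction N arbitrary: u)
  case (Suc N)
  let ?g = "(letter_mean n ^^ N) f"
  have "letter_mean n ((letter_mean n ^^ N) (\<lambda>u. (f u)\<^sup>2)) u \<le>
      letter_mean n (\<lambda>u. (?g u)\<^sup>2 + real N * L\<^sup>2) u"
    using Suc.IH[OF Suc.prems(1)] Suc.prems(2)
    by (intro letter_mean_mono) (simp add: algebra_simps)
  also have "\<dots> = letter_mean n (\<lambda>u. (?g u)\<^sup>2) u + real N * L\<^sup>2"
    using n by (simp add: letter_mean_add)
  also have "letter_mean n (\<lambda>u. (?g u)\<^sup>2) u \<le> (letter_mean n ?g u)\<^sup>2 + L\<^sup>2"
  proof -
    \<comment> \<open>Deviations are taken from \<open>?g u\<close>, the value before the letter is
      appended, rather than from the mean. The mean square about the mean is no larger.\<close>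
    let ?h = "\<lambda>x. ?g x - ?g u"
    have "letter_mean n (\<lambda>x. (?h x)\<^sup>2) u \<le> letter_mean n (\<lambda>_. L\<^sup>2) u"
    proof (rule letter_mean_mono)
      fix x assume "x \<in> letters n"
      then have "\<bar>?h (u @ [x])\<bar> \<le> L"
        using Suc.prems by auto
      then have "\<bar>?h (u @ [x])\<bar> \<le> \<bar>L\<bar>"
        by linarith
      then show "(?h (u @ [x]))\<^sup>2 \<le> L\<^sup>2"
        by (simp only: abs_le_square_iff)
    qed
    then have "letter_mean n (\<lambda>x. (?h x)\<^sup>2) u \<le> L\<^sup>2"
      using n by simp
    moreover have "letter_mean n (\<lambda>x. (?g x)\<^sup>2) u =
        letter_mean n (\<lambda>x. (?h x)\<^sup>2) u + (2 * ?g u * letter_mean n ?g u - (?g u)\<^sup>2)"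
    proof -
      have "letter_mean n (\<lambda>x. (?g x)\<^sup>2) u =
          letter_mean n (\<lambda>x. (?h x)\<^sup>2 + (2 * ?g u * ?g x + - (?g u)\<^sup>2)) u"
        by (simp add: power2_eq_square algebra_simps)
      also have "\<dots> = letter_mean n (\<lambda>x. (?h x)\<^sup>2) u + (2 * ?g u * letter_mean n ?g u + - (?g u)\<^sup>2)"
        by (simp only: letter_mean_add letter_mean_cmult letter_mean_const[OF n])
      finally show ?thesis
        by simp
    qed
    moreover have "2 * ?g u * letter_mean n ?g u - (?g u)\<^sup>2 \<le> (letter_mean n ?g u)\<^sup>2"
      using zero_le_power2[of "?g u - letter_mean n ?g u"] by (simp add: power2_diff)
    ultimately show ?thesis
      by linarith
  qed
  finally show ?case
    by (simp add: algebra_simps)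
qed simp

section \<open>Concentration of the roof size, first at time \<open>s * n\<close>, then at all later
  times\<close>

lemma one_plus_power_le_exp:
  fixes x :: real
  assumes "0 \<le> 1 + x"
  shows "(1 + x) ^ k \<le> exp (real k * x)"
  using power_mono[OF exp_ge_add_one_self assms, of k] by (simp add: exp_of_nat_mult)

lemma ntops_deviation_at:
  assumes n: "n \<ge> 1" and d: "d > 0"
  shows "word_mean n (s * n) (\<lambda>u. \<bar>real (ntops u) - word_mean n (s * n) (\<lambda>u. real (ntops u))\<bar>)
    \<le> d * real n + 9 * real s * exp (4 * real s) / d"
proof -
  let ?f = "\<lambda>u. real (ntops u)"
  define N where "N = s * n"
  define c where "c = word_mean n N ?f"
  \<comment> \<open>The constant 3 bounds the effect of a single letter on the roof; up to time
    \<open>s * n\<close> its influence grows by at most \<open>(1 + 2 / n) ^ (s * n)\<close>, which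
    is at most \<open>exp (2 * s)\<close>.\<close>
  define L where "L = 3 * exp (2 * real s)"
  have "\<bar>(letter_mean n ^^ j) ?f (u @ [x]) - (letter_mean n ^^ j) ?f u\<bar> \<le> L"
    if "j < N" "u \<in> lists (letters n)" "x \<in> letters n" for j x u
  proof -
    have "\<bar>(letter_mean n ^^ j) ?f (u @ [x]) - (letter_mean n ^^ j) ?f u\<bar> \<le>
        3 * (1 + 2 / real n) ^ j * real (card {fst x})"
      using ntops_append_diff_le that n
      by (intro letter_mean_append_diff_le) (auto simp: ntops_def dest: piling_of_cong)
    also have "(1 + 2 / real n) ^ j \<le> exp (real j * (2 / real n))"
      by (intro one_plus_power_le_exp) auto
    also have "real j * (2 / real n) \<le> real N * (2 / real n)"
      using that by (intro mult_right_mono) auto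
    also have "\<dots> = 2 * real s"
      using n by (simp add: N_def)
    finally show ?thesis
      by (simp add: L_def)
  qed
  then have var: "word_mean n N (\<lambda>u. (?f u)\<^sup>2) - c\<^sup>2 \<le> real N * L\<^sup>2"
    unfolding word_mean_def c_def using n by (intro letter_mean_variance_le) auto
  have dn: "0 < d * real n"
    using n d by simp
  \<comment> \<open>The second moment is converted to a first moment by
    \<open>|y| \<le> a + y^2 / a\<close> with \<open>a = d * n\<close>. The variance is of order
    \<open>n\<close>, so the last term stays bounded in \<open>n\<close>.\<close>
  have "word_mean n N (\<lambda>u. \<bar>?f u - c\<bar>) \<le> word_mean n N (\<lambda>u. d * real n + (?f u - c)\<^sup>2 / (d * real n))"
  proof (intro word_mean_mono)
    fix u
    have "0 \<le> (\<bar>?f u - c\<bar> - d * real n)\<^sup>2 + \<bar>?f u - c\<bar> * (d * real n)"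
      using dn by simp
    also have "\<dots> = (?f u - c)\<^sup>2 + (d * real n)\<^sup>2 - \<bar>?f u - c\<bar> * (d * real n)"
      by (simp add: power2_diff)
    finally have "\<bar>?f u - c\<bar> * (d * real n) \<le> (d * real n + (?f u - c)\<^sup>2 / (d * real n)) * (d * real n)"
      using dn by (simp add: distrib_right power2_eq_square)
    then show "\<bar>?f u - c\<bar> \<le> d * real n + (?f u - c)\<^sup>2 / (d * real n)"
      using dn by (simp only: mult_le_cancel_right_pos)
  qed
  also have "\<dots> = d * real n + word_mean n N (\<lambda>u. (?f u - c)\<^sup>2) / (d * real n)"
    using n by (simp add: word_mean_add word_mean_divide)
  also have "word_mean n N (\<lambda>u. (?f u - c)\<^sup>2) = word_mean n N (\<lambda>u. (?f u)\<^sup>2) - c\<^sup>2"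
  proof -
    have "word_mean n N (\<lambda>u. (?f u - c)\<^sup>2) = word_mean n N (\<lambda>u. (?f u)\<^sup>2 + (- 2 * c) * ?f u + c\<^sup>2)"
      by (intro word_mean_cong) (simp add: power2_diff)
    also have "\<dots> = word_mean n N (\<lambda>u. (?f u)\<^sup>2) + (- 2 * c) * c + c\<^sup>2"
      using n by (simp only: word_mean_add word_mean_cmult word_mean_const flip: c_def)
    finally show ?thesis
      by (simp add: power2_eq_square)
  qed
  also have "\<dots> / (d * real n) \<le> real N * L\<^sup>2 / (d * real n)"
    using var dn by (intro divide_right_mono) auto
  also have "\<dots> = 9 * real s * exp (4 * real s) / d"
    using n by (simp add: N_def L_def power_mult_distrib flip: exp_double)
  finally show ?thesis
    by (simp add: N_def c_def)
qed

text \<open>The gain \<open>1 / 2\<close> of \<open>pair_weight_step\<close>, divided by the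
  \<open>2 * n\<close> letters, gives the rate \<open>1 / (4 * n)\<close>.\<close>

lemma word_mean_pair_weight:
  assumes j: "j \<ge> 1" "Suc j \<le> n"
  shows "word_mean n N (pair_weight n j) \<le> (1 - 1 / (4 * real n)) ^ N"
proof (induction N)
  case 0
  show ?case
    by (simp add: pair_weight_Nil)
next
  case (Suc N)
  have n: "0 < real n"
    using j by simp
  have "word_mean n (Suc N) (pair_weight n j) \<le>
      word_mean n N (\<lambda>u. (1 - 1 / (4 * real n)) * pair_weight n j u)"
    unfolding word_mean_Suc
  proof (rule word_mean_mono)
    fix u assume "u \<in> lists (letters n)"
    then have "letter_mean n (pair_weight n j) u \<le> (2 * real n - 1 / 2) * pair_weight n j u / (2 * real n)"
      unfolding letter_mean_def using pair_weight_step j by (intro divide_right_mono) auto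
    also have "\<dots> = (1 - 1 / (4 * real n)) * pair_weight n j u"
      using n by (simp add: field_simps)
    finally show "letter_mean n (pair_weight n j) u \<le> (1 - 1 / (4 * real n)) * pair_weight n j u" .
  qed
  also have "\<dots> \<le> (1 - 1 / (4 * real n)) * (1 - 1 / (4 * real n)) ^ N"
    unfolding word_mean_cmult using Suc.IH n j by (intro mult_left_mono) (auto simp: field_simps)
  finally show ?case
    by simp
qed

lemma floor_deviation_Suc:
  assumes n: "n \<ge> 2"
  shows "word_mean n (Suc N) (\<lambda>u. \<bar>real (ntops (inv_word u)) - c\<bar>) \<le>
    word_mean n N (\<lambda>u. \<bar>real (ntops (inv_word u)) - c\<bar>) + 2 * (1 - 1 / (4 * real n)) ^ N"
proof -
  \<comment> \<open>The pair consists of the index of \<open>x\<close> and its right neighbour, or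
    its left neighbour if that index is \<open>n\<close>; a neighbour exists because
    \<open>n \<ge> 2\<close>.\<close>
  define k where "k x = (if fst x < n then fst x else n - 1)" for x :: letter
  have k: "k x \<ge> 1" "Suc (k x) \<le> n" "{k x, Suc (k x)} \<subseteq> {i. i = fst x \<or> nbr i (fst x)}"
    if "x \<in> letters n" for x
    using that n by (auto simp: k_def letters_def nbr_def)
  let ?h = "\<lambda>u. \<bar>real (ntops (inv_word u)) - c\<bar>"
  have "word_mean n (Suc N) ?h \<le>
      word_mean n N (\<lambda>u. ?h u + (\<Sum>x\<in>letters n. 2 * pair_weight n (k x) u) / (2 * real n))"
    unfolding word_mean_Suc
  proof (rule word_mean_mono)
    fix u assume u: "u \<in> lists (letters n)"
    have "letter_mean n ?h u \<le> (\<Sum>x\<in>letters n. ?h u + 2 * pair_weight n (k x) u) / (2 * real n)"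
      unfolding letter_mean_def
    proof (intro divide_right_mono sum_mono)
      fix x assume x: "x \<in> letters n"
      show "?h (u @ [x]) \<le> ?h u + 2 * pair_weight n (k x) u"
        using ntops_inv_word_snoc[OF u x k(3)[OF x]] by linarith
    qed simp
    also have "\<dots> = ?h u + (\<Sum>x\<in>letters n. 2 * pair_weight n (k x) u) / (2 * real n)"
      using n by (simp add: sum.distrib add_divide_distrib)
    finally show "letter_mean n ?h u \<le> \<dots>" .
  qed
  also have "\<dots> = word_mean n N ?h + (\<Sum>x\<in>letters n. 2 * word_mean n N (pair_weight n (k x))) / (2 * real n)"
    by (simp add: word_mean_add word_mean_divide word_mean_sum word_mean_cmult)
  also have "(\<Sum>x\<in>letters n. 2 * word_mean n N (pair_weight n (k x))) \<le>
      (\<Sum>x\<in>letters n. 2 * (1 - 1 / (4 * real n)) ^ N)"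
    using k word_mean_pair_weight by (intro sum_mono mult_left_mono) auto
  also have "\<dots> / (2 * real n) = 2 * (1 - 1 / (4 * real n)) ^ N"
    using n by simp
  finally show ?thesis
    by (simp add: divide_right_mono)
qed

text \<open>The increments \<open>2 * q ^ N\<close> with \<open>q = 1 - 1 / (4 * n)\<close> form a
  geometric series, and \<open>2 / (1 - q) = 8 * n\<close>.\<close>

lemma floor_deviation_add:
  assumes n: "n \<ge> 2"
  shows "word_mean n (M + k) (\<lambda>u. \<bar>real (ntops (inv_word u)) - c\<bar>) \<le>
    word_mean n M (\<lambda>u. \<bar>real (ntops (inv_word u)) - c\<bar>) +
    8 * real n * ((1 - 1 / (4 * real n)) ^ M - (1 - 1 / (4 * real n)) ^ (M + k))"
proof (induction k)
  case (Suc k)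
  define q where "q = 1 - 1 / (4 * real n)"
  have q: "8 * real n * (1 - q) = 2"
    using n by (simp add: q_def)
  have "8 * real n * (q ^ (M + k) - q ^ (M + Suc k)) = (8 * real n * (1 - q)) * q ^ (M + k)"
    by (simp add: algebra_simps)
  also have "\<dots> = 2 * q ^ (M + k)"
    by (simp only: q)
  finally have "8 * real n * (q ^ M - q ^ (M + Suc k)) =
      8 * real n * (q ^ M - q ^ (M + k)) + 2 * q ^ (M + k)"
    by (simp add: algebra_simps)
  then show ?case
    using Suc.IH floor_deviation_Suc[OF n, of "M + k" c] by (simp add: q_def)
qed simp

text \<open>The centre \<open>c\<close> is the mean at time \<open>s * n\<close> and serves for all
  later times. The first two error terms come from the variance at that time, the third from the
  later changes of the floor.\<close>

lemma ntops_deviation_le: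
  assumes n: "n \<ge> 2" and d: "d > 0"
  shows "\<exists>c. \<forall>N\<ge>s * n. word_mean n N (\<lambda>u. \<bar>real (ntops u) - c\<bar>) \<le>
    d * real n + 9 * real s * exp (4 * real s) / d + 8 * real n * exp (- real s / 4)"
proof (intro exI allI impI)
  fix N assume N: "N \<ge> s * n"
  define c where "c = word_mean n (s * n) (\<lambda>u. real (ntops u))"
  let ?q = "1 - 1 / (4 * real n)"
  have inv: "word_mean n m (\<lambda>u. \<bar>real (ntops (inv_word u)) - c\<bar>) = word_mean n m (\<lambda>u. \<bar>real (ntops u) - c\<bar>)" for m
    by (rule word_mean_inv_word)
  have q: "0 \<le> ?q"
    using n by (simp add: field_simps)
  have "word_mean n N (\<lambda>u. \<bar>real (ntops u) - c\<bar>) \<le>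
      word_mean n (s * n) (\<lambda>u. \<bar>real (ntops u) - c\<bar>) + 8 * real n * (?q ^ (s * n) - ?q ^ N)"
    using floor_deviation_add[OF n, of "s * n" "N - s * n" c] N unfolding inv by simp
  also have "8 * real n * (?q ^ (s * n) - ?q ^ N) \<le> 8 * real n * ?q ^ (s * n)"
    using zero_le_power[OF q, of N] by (intro mult_left_mono) auto
  also have "?q ^ (s * n) \<le> exp (real (s * n) * (- (1 / (4 * real n))))"
    using one_plus_power_le_exp[of "- (1 / (4 * real n))" "s * n"] q by simp
  also have "real (s * n) * (- (1 / (4 * real n))) = - real s / 4"
    using n by simp
  also have "word_mean n (s * n) (\<lambda>u. \<bar>real (ntops u) - c\<bar>) \<le> d * real n + 9 * real s * exp (4 * real s) / d"
    unfolding c_def using ntops_deviation_at n d by simp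
  finally show "word_mean n N (\<lambda>u. \<bar>real (ntops u) - c\<bar>) \<le>
      d * real n + 9 * real s * exp (4 * real s) / d + 8 * real n * exp (- real s / 4)"
    by (simp add: mult_left_mono)
qed

section \<open>The stationary balance\<close>

text \<open>The order of choices matters: first \<open>s\<close> makes the floor error a small
  fraction of \<open>n\<close>, then \<open>n\<close> is taken large to absorb the variance
  constant, which is exponential in \<open>s\<close>. The centre may depend on \<open>n\<close> but
  not on the time.\<close>

lemma eventually_ntops_concentrated:
  fixes e :: real
  assumes e: "e > 0"
  shows "\<forall>\<^sub>F n in sequentially. \<exists>c M. \<forall>N\<ge>M. word_mean n N (\<lambda>u. \<bar>real (ntops u) / real n - c\<bar>) \<le> e"
proof -
  have "((\<lambda>s. 8 * exp (- real s / 4)) \<longlongrightarrow> 0) sequentially"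
    by real_asymp
  then have "\<forall>\<^sub>F s in sequentially. 8 * exp (- real s / 4) < e / 3"
    by (rule order_tendstoD) (use e in simp)
  then obtain s where s: "8 * exp (- real s / 4) < e / 3"
    by (auto simp: eventually_sequentially)
  define C where "C = 9 * real s * exp (4 * real s) / (e / 3)"
  have "((\<lambda>n. C / real n) \<longlongrightarrow> 0) sequentially"
    by (rule lim_const_over_n)
  then have "\<forall>\<^sub>F n in sequentially. C / real n < e / 3"
    by (rule order_tendstoD) (use e in simp)
  then show ?thesis
    using eventually_ge_at_top[of 2]
  proof eventually_elim
    case (elim n)
    obtain c where c: "\<forall>N\<ge>s * n. word_mean n N (\<lambda>u. \<bar>real (ntops u) - c\<bar>) \<le>
        e / 3 * real n + C + 8 * real n * exp (- real s / 4)"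
      using ntops_deviation_le[OF elim(2), of "e / 3" s] e unfolding C_def by auto
    have n: "0 < real n"
      using elim(2) by simp
    have "word_mean n N (\<lambda>u. \<bar>real (ntops u) / real n - c / real n\<bar>) \<le> e" if "N \<ge> s * n" for N
    proof -
      have "word_mean n N (\<lambda>u. \<bar>real (ntops u) / real n - c / real n\<bar>) =
          word_mean n N (\<lambda>u. \<bar>real (ntops u) - c\<bar> / real n)"
        using n by (intro word_mean_cong) (simp flip: diff_divide_distrib)
      also have "\<dots> = word_mean n N (\<lambda>u. \<bar>real (ntops u) - c\<bar>) / real n"
        by (rule word_mean_divide)
      also have "\<dots> \<le> (e / 3 * real n + C + 8 * real n * exp (- real s / 4)) / real n"
        using c that n by (intro divide_right_mono) auto
      also have "\<dots> = e / 3 + C / real n + 8 * exp (- real s / 4)"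
        using n by (simp add: field_simps)
      also have "\<dots> \<le> e"
        using s elim(1) by linarith
      finally show ?thesis .
    qed
    then show ?case
      by blast
  qed
qed

lemma p_at_bounds:
  assumes "n \<ge> 1"
  shows "0 \<le> p_plus_at n w" "p_plus_at n w \<le> 1" "0 \<le> p_minus_at n w" "p_minus_at n w \<le> 1"
proof -
  have "0 \<le> cond_prob (measure_pmf (step n)) P Q \<and> cond_prob (measure_pmf (step n)) P Q \<le> 1" for P Q
  proof -
    have "card {x \<in> letters n. P x \<and> Q x} \<le> card {x \<in> letters n. Q x}"
      by (intro card_mono) auto
    then show ?thesis
      unfolding cond_prob_step[OF assms] by (auto simp: divide_le_eq_1 card_gt_0_iff)
  qed
  then show "0 \<le> p_plus_at n w" "p_plus_at n w \<le> 1" "0 \<le> p_minus_at n w" "p_minus_at n w \<le> 1"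
    by (simp_all add: p_plus_at_def p_minus_at_def)
qed

lemma cesaro_mean:
  fixes x :: "nat \<Rightarrow> real"
  assumes "x \<longlonglongrightarrow> L"
  shows "(\<lambda>N. (\<Sum>i<N. x i) / real N) \<longlonglongrightarrow> L"
proof (rule LIMSEQ_I)
  fix r :: real assume r: "r > 0"
  obtain M where M: "\<And>i. i \<ge> M \<Longrightarrow> \<bar>x i - L\<bar> < r / 2"
    using LIMSEQ_D[OF assms, of "r / 2"] r by auto
  define B where "B = (\<Sum>i<M. \<bar>x i - L\<bar>)"
  \<comment> \<open>Beyond \<open>N0\<close> the first \<open>M\<close> deviations, of total size
    \<open>B\<close>, contribute less than \<open>r / 2\<close> to the average.\<close>
  obtain N0 where N0: "2 * B / r < real N0"
    using reals_Archimedean2 by blast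
  show "\<exists>no. \<forall>N\<ge>no. norm ((\<Sum>i<N. x i) / real N - L) < r"
  proof (intro exI allI impI)
    fix N assume N: "N \<ge> Suc N0"
    then have N_pos: "0 < real N"
      by simp
    have "2 * B < r * real N"
      using N0 N r by (simp add: field_simps) (smt (verit, best) mult_le_cancel_left_pos of_nat_mono Suc_leD)
    have "\<bar>\<Sum>i<N. x i - L\<bar> \<le> (\<Sum>i<N. \<bar>x i - L\<bar>)"
      by (rule sum_abs)
    also have "\<dots> \<le> (\<Sum>i<N. (if i < M then \<bar>x i - L\<bar> else 0) + r / 2)"
      using M r by (intro sum_mono) (auto simp: not_less less_imp_le)
    also have "\<dots> = (\<Sum>i<N. if i < M then \<bar>x i - L\<bar> else 0) + real N * (r / 2)"
      by (simp add: sum.distrib)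
    also have "(\<Sum>i<N. if i < M then \<bar>x i - L\<bar> else 0) = (\<Sum>i\<in>{..<N} \<inter> {..<M}. \<bar>x i - L\<bar>)"
      by (subst sum.inter_restrict) (auto intro!: sum.cong)
    also have "\<dots> \<le> B"
      unfolding B_def by (intro sum_mono2) auto
    finally have "\<bar>\<Sum>i<N. x i - L\<bar> < r * real N"
      using \<open>2 * B < r * real N\<close> by (simp add: mult.commute[of r])
    moreover have "(\<Sum>i<N. x i) / real N - L = (\<Sum>i<N. x i - L) / real N"
      using N_pos by (simp add: sum_subtractf field_simps)
    ultimately show "norm ((\<Sum>i<N. x i) / real N - L) < r"
      using N_pos by (simp add: divide_less_eq)
  qed
qed

section \<open>The drift and the limit of the one-step balance\<close>

lemma word_mean_length_Suc:
  assumes "n \<ge> 1"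
  shows "word_mean n (Suc N) (\<lambda>u. real (psize n (piling_of u))) =
    word_mean n N (\<lambda>u. real (psize n (piling_of u))) + (1 - word_mean n N (\<lambda>u. real (ntops u)) / real n)"
proof -
  let ?k = "\<lambda>u. real (psize n (piling_of u))"
  have "word_mean n (Suc N) ?k = word_mean n N (\<lambda>u. ?k u + (1 - real (ntops u) / real n))"
    unfolding word_mean_Suc
  proof (rule word_mean_cong)
    fix u assume "u \<in> lists (letters n)"
    from sum_psize_step[OF this] have "(\<Sum>x\<in>letters n. ?k (u @ [x])) =
        2 * real n * ?k u + (2 * real n - 2 * real (ntops u))"
      by (simp add: sum_subtractf)
    then show "letter_mean n ?k u = ?k u + (1 - real (ntops u) / real n)"
      using assms by (simp add: letter_mean_def field_simps)
  qed
  then show ?thesis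
    using assms by (simp only: word_mean_add word_mean_diff word_mean_divide word_mean_const)
qed

lemma walk_mean_ntops:
  "n \<ge> 1 \<Longrightarrow> walk_mean n (\<lambda>w. real (card (roof n w))) = (\<lambda>N. word_mean n N (\<lambda>u. real (ntops u)))"
  by (simp add: fun_eq_iff walk_mean_eq_word_mean card_roof cong: word_mean_cong)

text \<open>The mean length is the sum of the increments \<open>1 - E #T / n\<close>, which
  converge; Cesaro averaging turns the limsup in the drift into a limit. No error in
  \<open>n\<close> arises here.\<close>

lemma drift_eq:
  assumes n: "n \<ge> 1" and conv: "convergent (walk_mean n (\<lambda>w. real (card (roof n w))))"
  shows "drift n = 1 - mean_roof n / real n"
proof -
  let ?t = "\<lambda>N. word_mean n N (\<lambda>u. real (ntops u))"
  have t: "?t \<longlonglongrightarrow> mean_roof n"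
    using conv n unfolding mean_roof_def stat_mean_def convergent_LIMSEQ_iff
    by (simp add: walk_mean_ntops)
  have K: "walk_mean n (\<lambda>w. real (K n w)) N = (\<Sum>i<N. 1 - ?t i / real n)" for N
  proof -
    have "walk_mean n (\<lambda>w. real (K n w)) N = word_mean n N (\<lambda>u. real (psize n (piling_of u)))"
      using n by (simp add: walk_mean_eq_word_mean K_eq_psize cong: word_mean_cong)
    also have "\<dots> = (\<Sum>i<N. 1 - ?t i / real n)"
      by (induction N) (simp_all add: word_mean_length_Suc[OF n])
    finally show ?thesis .
  qed
  have "(\<lambda>N. 1 - ?t N / real n) \<longlonglongrightarrow> 1 - mean_roof n / real n"
    by (intro tendsto_intros t) (use n in auto)
  from cesaro_mean[OF this] have "(\<lambda>N. walk_mean n (\<lambda>w. real (K n w)) N / real N) \<longlonglongrightarrow> 1 - mean_roof n / real n"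
    by (simp only: K)
  then have "limsup (\<lambda>N. ereal (walk_mean n (\<lambda>w. real (K n w)) N / real N)) = ereal (1 - mean_roof n / real n)"
    by (intro lim_imp_Limsup tendsto_ereal) auto
  then show ?thesis
    by (simp add: drift_def)
qed

text \<open>This is \<open>sum_ntops_step\<close> averaged over words: dividing by the
  \<open>2 * n\<close> letters turns the boundary error 4 into \<open>2 / n\<close>.\<close>

lemma abs_ntops_balance_le:
  assumes n: "n \<ge> 1"
  defines "D \<equiv> \<lambda>u. p_plus_at n (lf_class n u) - p_minus_at n (lf_class n u)"
  shows "\<bar>word_mean n (Suc N) (\<lambda>u. real (ntops u)) - word_mean n N (\<lambda>u. real (ntops u)) -
    (1 - 3 * word_mean n N (\<lambda>u. real (ntops u) / real n) +
     word_mean n N (\<lambda>u. real (ntops u) / real n * D u) / 2)\<bar> \<le> 2 / real n"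
proof -
  let ?f = "\<lambda>u. real (ntops u)"
  let ?g = "\<lambda>u. ?f u + (1 - 3 * (?f u / real n) + ?f u / real n * D u / 2)"
  have "\<bar>letter_mean n ?f u - ?g u\<bar> \<le> 2 / real n" if "u \<in> lists (letters n)" for u
  proof -
    have "letter_mean n ?f u - ?g u =
        ((\<Sum>x\<in>letters n. ?f (u @ [x]) - ?f u) - (2 * real n - 6 * ?f u + ?f u * D u)) / (2 * real n)"
      using n by (simp add: letter_mean_def sum_subtractf field_simps)
    also have "\<bar>\<dots>\<bar> \<le> 4 / (2 * real n)"
      unfolding abs_divide using sum_ntops_step[OF that n] n
      by (intro frac_le) (auto simp: D_def)
    finally show ?thesis
      by simp
  qed
  then have "word_mean n N (\<lambda>u. \<bar>letter_mean n ?f u - ?g u\<bar>) \<le> word_mean n N (\<lambda>_. 2 / real n)"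
    by (intro word_mean_mono)
  then have "\<bar>word_mean n N (\<lambda>u. letter_mean n ?f u - ?g u)\<bar> \<le> 2 / real n"
    using abs_word_mean_le[of n N "\<lambda>u. letter_mean n ?f u - ?g u"] n by simp
  moreover have "word_mean n N (\<lambda>u. letter_mean n ?f u - ?g u) =
      word_mean n (Suc N) ?f - (word_mean n N ?f + (1 - 3 * word_mean n N (\<lambda>u. ?f u / real n) +
      word_mean n N (\<lambda>u. ?f u / real n * D u) / 2))"
    by (simp only: word_mean_diff word_mean_add word_mean_divide word_mean_cmult word_mean_const[OF n]
        word_mean_Suc)
  ultimately show ?thesis
    by (simp add: algebra_simps)
qed

text \<open>Replacing \<open>g\<close> by the constant \<open>c\<close> makes the covariance vanish,
  and costs at most the mean of \<open>|g - c|\<close> in each of the two terms.\<close>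

lemma abs_word_mean_covariance_le:
  assumes n: "n \<ge> 1" and D: "\<And>u. \<bar>D u\<bar> \<le> 1"
  shows "\<bar>word_mean n N (\<lambda>u. g u * D u) - word_mean n N g * word_mean n N D\<bar>
    \<le> 2 * word_mean n N (\<lambda>u. \<bar>g u - c\<bar>)"
proof -
  have 1: "\<bar>word_mean n N (\<lambda>u. (g u - c) * D u)\<bar> \<le> word_mean n N (\<lambda>u. \<bar>g u - c\<bar>)"
  proof -
    have "\<bar>word_mean n N (\<lambda>u. (g u - c) * D u)\<bar> \<le> word_mean n N (\<lambda>u. \<bar>(g u - c) * D u\<bar>)"
      by (rule abs_word_mean_le)
    also have "\<dots> \<le> word_mean n N (\<lambda>u. \<bar>g u - c\<bar>)"
      by (intro word_mean_mono) (simp add: abs_mult D mult_left_le)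
    finally show ?thesis .
  qed
  have "\<bar>word_mean n N D\<bar> \<le> word_mean n N (\<lambda>_. 1)"
    by (intro order_trans[OF abs_word_mean_le] word_mean_mono D)
  then have D': "\<bar>word_mean n N D\<bar> \<le> 1"
    using n by simp
  have "\<bar>(word_mean n N g - c) * word_mean n N D\<bar> \<le> \<bar>word_mean n N g - c\<bar>"
    using D' by (simp add: abs_mult mult_left_le)
  also have "\<dots> \<le> word_mean n N (\<lambda>u. \<bar>g u - c\<bar>)"
    using abs_word_mean_le[of n N "\<lambda>u. g u - c"] n by (simp add: word_mean_diff)
  finally have 2: "\<bar>(word_mean n N g - c) * word_mean n N D\<bar> \<le> word_mean n N (\<lambda>u. \<bar>g u - c\<bar>)" .
  have "word_mean n N (\<lambda>u. (g u - c) * D u) = word_mean n N (\<lambda>u. g u * D u - c * D u)"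
    by (simp add: algebra_simps)
  also have "\<dots> = word_mean n N (\<lambda>u. g u * D u) - c * word_mean n N D"
    by (simp only: word_mean_diff word_mean_cmult)
  finally have "word_mean n N (\<lambda>u. g u * D u) - word_mean n N g * word_mean n N D =
      word_mean n N (\<lambda>u. (g u - c) * D u) - (word_mean n N g - c) * word_mean n N D"
    by (simp add: algebra_simps)
  then show ?thesis
    using 1 2 by linarith
qed

text \<open>The bound on \<open>alpha n\<close> keeps \<open>3 - alpha n\<close> away from 0
  uniformly in \<open>n\<close>, which the final division requires.\<close>

lemma abs_alpha_le:
  assumes n: "n \<ge> 1"
    and "convergent (walk_mean n (p_plus_at n))" "convergent (walk_mean n (p_minus_at n))"
  shows "(\<lambda>N. word_mean n N (\<lambda>u. p_plus_at n (lf_class n u) - p_minus_at n (lf_class n u))) \<longlonglongrightarrow> 2 * alpha n"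
    and "\<bar>alpha n\<bar> \<le> 1 / 2"
proof -
  let ?D = "\<lambda>N. word_mean n N (\<lambda>u. p_plus_at n (lf_class n u) - p_minus_at n (lf_class n u))"
  have "walk_mean n (p_plus_at n) \<longlonglongrightarrow> p_plus n" "walk_mean n (p_minus_at n) \<longlonglongrightarrow> p_minus n"
    using assms(2,3) by (simp_all add: p_plus_def p_minus_def stat_mean_def convergent_LIMSEQ_iff)
  moreover have "2 * alpha n = p_plus n - p_minus n"
    by (simp add: alpha_def field_simps)
  ultimately show lim: "?D \<longlonglongrightarrow> 2 * alpha n"
    using tendsto_diff by (simp add: walk_mean_eq_word_mean[OF n, abs_def] word_mean_diff)
  have "\<bar>?D N\<bar> \<le> 1" for N
  proof -
    have "\<bar>?D N\<bar> \<le> word_mean n N (\<lambda>u. \<bar>p_plus_at n (lf_class n u) - p_minus_at n (lf_class n u)\<bar>)"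
      by (rule abs_word_mean_le)
    also have "\<dots> \<le> word_mean n N (\<lambda>_. 1)"
    proof (rule word_mean_mono)
      fix u
      show "\<bar>p_plus_at n (lf_class n u) - p_minus_at n (lf_class n u)\<bar> \<le> 1"
        using p_at_bounds[OF n, of "lf_class n u"] by linarith
    qed
    finally show ?thesis
      using n by simp
  qed
  then have "\<bar>2 * alpha n\<bar> \<le> 1"
    by (intro tendsto_upperbound[OF tendsto_rabs[OF lim]]) auto
  then show "\<bar>alpha n\<bar> \<le> 1 / 2"
    by simp
qed

lemma abs_roof_density_le:
  assumes n: "n \<ge> 1"
    and conv: "convergent (walk_mean n (\<lambda>w. real (card (roof n w))))"
      "convergent (walk_mean n (p_plus_at n))" "convergent (walk_mean n (p_minus_at n))"
    and conc: "\<And>N. N \<ge> M \<Longrightarrow> word_mean n N (\<lambda>u. \<bar>real (ntops u) / real n - c\<bar>) \<le> e"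
  shows "\<bar>1 - (3 - alpha n) * (mean_roof n / real n)\<bar> \<le> 2 / real n + e"
proof -
  define D where "D u = p_plus_at n (lf_class n u) - p_minus_at n (lf_class n u)" for u
  define t where "t N = word_mean n N (\<lambda>u. real (ntops u))" for N
  define a where "a N = word_mean n N D" for N
  have t: "t \<longlonglongrightarrow> mean_roof n"
    using conv(1) n unfolding mean_roof_def stat_mean_def convergent_LIMSEQ_iff t_def
    by (simp add: walk_mean_ntops)
  have a: "a \<longlonglongrightarrow> 2 * alpha n"
    unfolding a_def D_def[abs_def] by (rule abs_alpha_le[OF n conv(2,3)])
  have D: "\<bar>D u\<bar> \<le> 1" for u
    using p_at_bounds[OF n, of "lf_class n u"] unfolding D_def by linarith
  \<comment> \<open>The covariance error is at most \<open>2 * e\<close> and enters the balance with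
    the factor \<open>1 / 2\<close>.\<close>
  have combine: "\<bar>x - (1 - y + q / 2)\<bar> \<le> b + e"
    if "\<bar>x - (1 - y + p / 2)\<bar> \<le> b" "z \<le> e" "\<bar>p - q\<bar> \<le> 2 * z" for x y z p q b :: real
    using that by linarith
  have "\<bar>t (Suc N) - t N - (1 - 3 * (t N / real n) + t N / real n * a N / 2)\<bar> \<le> 2 / real n + e"
    if "N \<ge> M" for N
    using abs_ntops_balance_le[OF n, of N] conc[OF that]
      abs_word_mean_covariance_le[OF n, of D N "\<lambda>u. real (ntops u) / real n" c, OF D]
    unfolding D_def[symmetric] word_mean_divide[of n N "\<lambda>u. real (ntops u)"] t_def a_def
    by (rule combine)
  then have "\<forall>\<^sub>F N in sequentially.
      \<bar>t (Suc N) - t N - (1 - 3 * (t N / real n) + t N / real n * a N / 2)\<bar> \<le> 2 / real n + e"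
    by (auto simp: eventually_sequentially)
  \<comment> \<open>The increment of the convergent sequence \<open>t\<close> tends to 0; it appears
    in the limit as \<open>mean_roof n - mean_roof n\<close>.\<close>
  moreover have "(\<lambda>N. \<bar>t (Suc N) - t N - (1 - 3 * (t N / real n) + t N / real n * a N / 2)\<bar>) \<longlonglongrightarrow>
      \<bar>mean_roof n - mean_roof n - (1 - 3 * (mean_roof n / real n) + mean_roof n / real n * (2 * alpha n) / 2)\<bar>"
    by (intro tendsto_intros t a LIMSEQ_Suc) (use n in auto)
  ultimately have "\<bar>mean_roof n - mean_roof n - (1 - 3 * (mean_roof n / real n) + mean_roof n / real n * (2 * alpha n) / 2)\<bar>
      \<le> 2 / real n + e"
    by (intro tendsto_upperbound) auto
  then show ?thesis
    by (simp add: algebra_simps)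
qed

text \<open>For \<open>n \<ge> 1\<close> the first and third differences are exactly 0, so the
  asymptotic error sits entirely in the middle one. There the balance is divided by
  \<open>3 - alpha n\<close>, which is at least 2.\<close>

theorem theorem3:
  assumes "\<And>n. n \<ge> 1 \<Longrightarrow> convergent (walk_mean n (\<lambda>w. real (card (roof n w))))"
    and "\<And>n. n \<ge> 1 \<Longrightarrow> convergent (walk_mean n (p_plus_at n))"
    and "\<And>n. n \<ge> 1 \<Longrightarrow> convergent (walk_mean n (p_minus_at n))"
  shows "(\<lambda>n. drift n - (1 - mean_roof n / real n)) \<longlonglongrightarrow> 0 \<and>
    (\<lambda>n. (1 - mean_roof n / real n) - (1 - 1 / (3 - alpha n))) \<longlonglongrightarrow> 0 \<and>
    (\<lambda>n. (1 - 1 / (3 - alpha n)) - (2 - alpha n) / (3 - alpha n)) \<longlonglongrightarrow> 0"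
proof (intro conjI)
  have alpha: "3 - alpha n \<ge> 2" if "n \<ge> 1" for n
    using abs_alpha_le(2)[OF that assms(2,3)] that by (simp add: abs_le_iff)
  show "(\<lambda>n. drift n - (1 - mean_roof n / real n)) \<longlonglongrightarrow> 0"
    using drift_eq assms(1) by (intro tendsto_eventually eventually_sequentiallyI[of 1]) simp
  show "(\<lambda>n. (1 - 1 / (3 - alpha n)) - (2 - alpha n) / (3 - alpha n)) \<longlonglongrightarrow> 0"
    using alpha by (intro tendsto_eventually eventually_sequentiallyI[of 1]) (force simp: field_simps)
  show "(\<lambda>n. (1 - mean_roof n / real n) - (1 - 1 / (3 - alpha n))) \<longlonglongrightarrow> 0"
  proof (rule tendstoI)
    fix e :: real assume e: "e > 0"
    have "((\<lambda>n. 2 / real n) \<longlongrightarrow> 0) sequentially"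
      by (rule lim_const_over_n)
    then have "\<forall>\<^sub>F n in sequentially. 2 / real n < e / 2"
      by (rule order_tendstoD) (use e in simp)
    then show "\<forall>\<^sub>F n in sequentially. dist ((1 - mean_roof n / real n) - (1 - 1 / (3 - alpha n))) 0 < e"
      using eventually_ntops_concentrated[OF half_gt_zero[OF e]] eventually_ge_at_top[of 1]
    proof eventually_elim
      case (elim n)
      obtain c M where "\<And>N. N \<ge> M \<Longrightarrow> word_mean n N (\<lambda>u. \<bar>real (ntops u) / real n - c\<bar>) \<le> e / 2"
        using elim(2) e by auto
      then have "\<bar>1 - (3 - alpha n) * (mean_roof n / real n)\<bar> \<le> 2 / real n + e / 2"
        using assms elim(3) by (intro abs_roof_density_le)
      also have "\<dots> < e"
        using elim(1) by simp
      finally have less: "\<bar>1 - (3 - alpha n) * (mean_roof n / real n)\<bar> < e" .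
      have "(1 - mean_roof n / real n) - (1 - 1 / (3 - alpha n)) =
          (1 - (3 - alpha n) * (mean_roof n / real n)) / (3 - alpha n)"
        using alpha[OF elim(3)] by (simp add: diff_divide_distrib)
      also have "\<bar>\<dots>\<bar> \<le> \<bar>1 - (3 - alpha n) * (mean_roof n / real n)\<bar> / 1"
        unfolding abs_divide using alpha[OF elim(3)] by (intro divide_left_mono) auto
      finally show ?case
        using less by (simp add: dist_real_def)
    qed
  qed
qed

end
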